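(* (i) Let $A$ be a $C^*$-algebra. Then $LM(A)=M(A)$ if and only if $QM(A)=M(A)$. Let $A,B$ be $C^*$-algebras and let $X$ be an $A$-$B$ Hilbert $C^*$-bimodule. (ii) Then $QM(X)=LM(X)$ if and only if $RM(X)\subset LM(X)$. (iii) Then $QM(X)=RM(X)$ if and only if $LM(X)\subset RM(X)$. Let $X$ be an $A$-$B$ imprimitivity bimodule and $L$ its linking algebra. (iv) Then $QM(X)=LM(X)$ if and only if $QM(A)=M(A)$. (v) Then $QM(X)=RM(X)$ if and only if $QM(B)=M(B)$. (vi) Then $QM(X)=M(X)$ if and only if $QM(L)=M(L)$.
   Context: For a $C^*$-algebra $A$ with double dual (enveloping von Neumann algebra) $A^{**}\supset A$, define subsets of $A^{**}$: $LM(A)=\{T: Ta\in A\ \forall a\in A\}$ (left multipliers), $RM(A)=\{T: aT\in A\ \forall a\in A\}$ (right multipliers), $M(A)=LM(A)\cap RM(A)$ (multipliers), $QM(A)=\{T: aTb\in A\ \forall a,b\in A\}$ (quasi-multipliers). Hilbert $C^*$-bimodules (working definition): an $A$-$B$ Hilbert $C^*$-bimodule $X$ has a linking algebra $L$, which is a $C^*$-algebra endowed with two projections $p,q\in M(L)$, $p+q=\mathbf{1}$, such that $pLp$ is identified with $A$, $qLq$ is identified with $B$, and $pLq$ is identified with $X$ (module actions and inner products coming from the multiplication and involution of $L$: $\langle x,y\rangle_A=xy^*$, $\langle x,y\rangle_B=x^*y$). $X$ is an $A$-$B$ imprimitivity bimodule if and only if each of $A$ and $B$ generates $L$ as a (closed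 two-sided) ideal. Define $M(X)=pM(L)q$, $LM(X)=pLM(L)q$, $RM(X)=pRM(L)q$, $QM(X)=pQM(L)q$, all subsets of $X^{**}=pL^{**}q$. Equivalently, for $T\in X^{**}$: $T\in LM(X)$ iff $Tb\in X$ for all $b\in B$; $T\in RM(X)$ iff $aT\in X$ for all $a\in A$; $M(X)=LM(X)\cap RM(X)$; $T\in QM(X)$ iff $aTb\in X$ for all $a\in A$, $b\in B$. *)

theory Defs
  imports "HOL-Analysis.Analysis"
begin

section \<open>C*-algebras\<close>

class complex_normed_vector = real_normed_vector +
  fixes scaleC :: "complex \<Rightarrow> 'a \<Rightarrow> 'a"  (infixr \<open>*\<^sub>C\<close> 75)
  assumes scaleC_add_right: "c *\<^sub>C (x + y) = c *\<^sub>C x + c *\<^sub>C y"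
    and scaleC_add_left: "(c + d) *\<^sub>C x = c *\<^sub>C x + d *\<^sub>C x"
    and scaleC_scaleC: "c *\<^sub>C (d *\<^sub>C x) = (c * d) *\<^sub>C x"
    and scaleC_of_real: "complex_of_real r *\<^sub>C x = r *\<^sub>R x"
    and norm_scaleC: "norm (c *\<^sub>C x) = cmod c * norm x"

text \<open>Not necessarily unital; the zero algebra is allowed.\<close>

class cstar_algebra = complex_normed_vector + real_normed_algebra + complete_space +
  fixes star :: "'a \<Rightarrow> 'a"
  assumes mult_scaleC_left: "(c *\<^sub>C x) * y = c *\<^sub>C (x * y)"
    and mult_scaleC_right: "x * (c *\<^sub>C y) = c *\<^sub>C (x * y)"
    and star_add: "star (x + y) = star x + star y"
    and star_scaleC: "star (c *\<^sub>C x) = cnj c *\<^sub>C star x"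
    and star_mult: "star (x * y) = star y * star x"
    and star_star: "star (star x) = x"
    and cstar_identity: "norm (star x * x) = (norm x)\<^sup>2"

lemma norm_star: "norm (star x) = norm (x :: 'a :: cstar_algebra)"
proof -
  have le: "norm y \<le> norm (star y)" for y :: 'a
  proof (cases "y = 0")
    case False
    have "norm y * norm y = norm (star y * y)"
      by (simp add: cstar_identity power2_eq_square)
    also have "\<dots> \<le> norm (star y) * norm y"
      by (rule norm_mult_ineq)
    finally show ?thesis
      using False by simp
  qed simp
  show ?thesis
    using le[of x] le[of "star x"] by (simp add: star_star)
qed

lemma bounded_linear_star: "bounded_linear (star :: 'a \<Rightarrow> 'a :: cstar_algebra)"
proof (rule bounded_linear_intro[of _ 1])
  show "star (r *\<^sub>R x) = r *\<^sub>R star x" for r and x :: 'a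
    by (metis scaleC_of_real star_scaleC complex_cnj_complex_of_real)
qed (simp_all add: star_add norm_star)


section \<open>The Banach space dual\<close>

typedef (overloaded) ('a :: complex_normed_vector) cdual =
  "{f :: 'a \<Rightarrow> complex. bounded_linear f \<and> (\<forall>c x. f (c *\<^sub>C x) = c * f x)}"
  morphisms cdual_apply Cdual
  by (rule exI[of _ "\<lambda>_. 0"]) simp

declare [[coercion cdual_apply]]

setup_lifting type_definition_cdual

lemma bounded_linear_cdual_apply: "bounded_linear (cdual_apply f)"
  using cdual_apply[of f] by simp

lemma cdual_apply_scaleC_arg: "cdual_apply f (c *\<^sub>C x) = c * cdual_apply f x"
  using cdual_apply[of f] by simp

lemma cdual_apply_add_arg: "cdual_apply f (x + y) = cdual_apply f x + cdual_apply f y"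
  using bounded_linear_cdual_apply[of f]
  by (simp add: linear_simps)

lemma cdual_eqI: "(\<And>x. cdual_apply f x = cdual_apply g x) \<Longrightarrow> f = g"
  by transfer auto

instantiation cdual :: (complex_normed_vector) real_normed_vector
begin

lift_definition zero_cdual :: "'a cdual" is "\<lambda>_. 0" by simp

lift_definition plus_cdual :: "'a cdual \<Rightarrow> 'a cdual \<Rightarrow> 'a cdual" is "\<lambda>f g x. f x + g x"
  by (auto simp: bounded_linear_add algebra_simps)

lift_definition minus_cdual :: "'a cdual \<Rightarrow> 'a cdual \<Rightarrow> 'a cdual" is "\<lambda>f g x. f x - g x"
  by (auto simp: bounded_linear_sub algebra_simps)

lift_definition uminus_cdual :: "'a cdual \<Rightarrow> 'a cdual" is "\<lambda>f x. - f x"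
  by (auto simp: bounded_linear_minus)

lift_definition scaleR_cdual :: "real \<Rightarrow> 'a cdual \<Rightarrow> 'a cdual" is "\<lambda>r f x. r *\<^sub>R f x"
  by (auto simp: bounded_linear_const_scaleR)

lift_definition norm_cdual :: "'a cdual \<Rightarrow> real" is onorm .

definition sgn_cdual :: "'a cdual \<Rightarrow> 'a cdual"
  where "sgn_cdual f = scaleR (inverse (norm f)) f"

definition dist_cdual :: "'a cdual \<Rightarrow> 'a cdual \<Rightarrow> real"
  where "dist_cdual f g = norm (f - g)"

definition uniformity_cdual :: "('a cdual \<times> 'a cdual) filter"
  where "uniformity_cdual = (INF e\<in>{0 <..}. principal {(f, g). dist f g < e})"

definition open_cdual :: "'a cdual set \<Rightarrow> bool"
  where "open_cdual U = (\<forall>f\<in>U. \<forall>\<^sub>F (f', g) in uniformity. f' = f \<longrightarrow> g \<in> U)"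

instance
proof
  fix f g h :: "'a cdual" and r s :: real
  show "f + g + h = f + (g + h)" "f + g = g + f" "0 + f = f" "- f + f = 0" "f - g = f + - g"
    by (transfer, force)+
  show "r *\<^sub>R (f + g) = r *\<^sub>R f + r *\<^sub>R g" "(r + s) *\<^sub>R f = r *\<^sub>R f + s *\<^sub>R f"
       "r *\<^sub>R s *\<^sub>R f = (r * s) *\<^sub>R f" "1 *\<^sub>R f = f"
    by (transfer, force simp: algebra_simps)+
  show "dist f g = norm (f - g)" by (rule dist_cdual_def)
  show "sgn f = inverse (norm f) *\<^sub>R f" by (rule sgn_cdual_def)
  show "uniformity = (INF e\<in>{0 <..}. principal {(f, g :: 'a cdual). dist f g < e})"
    by (rule uniformity_cdual_def)
  show "open U = (\<forall>f\<in>U. \<forall>\<^sub>F (f', g) in uniformity. f' = f \<longrightarrow> g \<in> U)" for U :: "'a cdual set"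
    by (rule open_cdual_def)
  show "(norm f = 0) = (f = 0)"
    by transfer (auto simp: onorm_eq_0 fun_eq_iff)
  show "norm (f + g) \<le> norm f + norm g"
    by transfer (auto intro: onorm_triangle)
  show "norm (r *\<^sub>R f) = \<bar>r\<bar> * norm f"
    by transfer (auto simp: onorm_scaleR)
qed

end

instantiation cdual :: (complex_normed_vector) complex_normed_vector
begin

lift_definition scaleC_cdual :: "complex \<Rightarrow> 'a cdual \<Rightarrow> 'a cdual" is "\<lambda>c f x. c * f x"
  by (auto simp: bounded_linear_const_mult)

instance
proof
  fix f g :: "'a cdual" and r :: real and c d :: complex
  show "c *\<^sub>C (f + g) = c *\<^sub>C f + c *\<^sub>C g" "(c + d) *\<^sub>C f = c *\<^sub>C f + d *\<^sub>C f"
       "c *\<^sub>C d *\<^sub>C f = (c * d) *\<^sub>C f"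
    by (transfer, force simp: algebra_simps)+
  show "complex_of_real r *\<^sub>C f = r *\<^sub>R f"
    by (transfer, force simp: scaleR_conv_of_real)
  show "norm (c *\<^sub>C f) = cmod c * norm f"
  proof transfer
    fix c :: complex and f :: "'a \<Rightarrow> complex"
    assume *: "bounded_linear f \<and> (\<forall>c x. f (c *\<^sub>C x) = c * f x)"
    have "onorm (\<lambda>x. c * f x) = onorm (\<lambda>x. cmod c *\<^sub>R f x)"
      by (simp add: onorm_def norm_mult)
    also have "\<dots> = cmod c * onorm f"
      using onorm_scaleR[of f "cmod c"] * by simp
    finally show "onorm (\<lambda>x. c * f x) = cmod c * onorm f" .
  qed
qed

end

lemma norm_cdual_apply_le: "cmod (cdual_apply f x) \<le> norm f * norm x"
  by transfer (simp add: onorm)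

lemma norm_cdual_le:
  assumes "\<And>x. cmod (cdual_apply f x) \<le> K * norm x" "K \<ge> 0"
  shows "norm f \<le> K"
  using assms by transfer (auto intro: onorm_bound)


section \<open>The enveloping von Neumann algebra\<close>

text \<open>
  The enveloping von Neumann algebra is the Banach space bidual with the Arens product and the
  bitransposed involution. (C*-algebras are Arens regular, so the two Arens products coincide;
  the first one is used here.)
\<close>

type_synonym 'a bidual = "'a cdual cdual"

lift_definition to_bidual :: "'a :: complex_normed_vector \<Rightarrow> 'a bidual" is "\<lambda>a f. cdual_apply f a"
proof (intro conjI allI bounded_linear_intro)
  fix a :: 'a and f :: "'a cdual"
  show "cmod (cdual_apply f a) \<le> norm f * norm a"
    by (rule norm_cdual_apply_le)
qed (simp_all add: plus_cdual.rep_eq scaleR_cdual.rep_eq scaleC_cdual.rep_eq)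

lift_definition cdual_ract :: "'a :: cstar_algebra cdual \<Rightarrow> 'a \<Rightarrow> 'a cdual" is "\<lambda>f a b. f (a * b)"
  by (auto intro: bounded_linear_compose bounded_linear_mult_right simp: mult_scaleC_right)

lemma norm_cdual_ract: "norm (cdual_ract f a) \<le> norm f * norm a"
proof (rule norm_cdual_le)
  fix b
  have "cmod (f (a * b)) \<le> norm f * norm (a * b)"
    by (rule norm_cdual_apply_le)
  also have "\<dots> \<le> norm f * (norm a * norm b)"
    by (intro mult_left_mono norm_mult_ineq norm_ge_zero)
  finally show "cmod (cdual_ract f a b) \<le> norm f * norm a * norm b"
    by (simp add: cdual_ract.rep_eq mult.assoc)
qed simp

lemma cdual_ract_linear:
  "cdual_ract f (a + b) = cdual_ract f a + cdual_ract f b"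
  "cdual_ract f (c *\<^sub>C a) = c *\<^sub>C cdual_ract f a"
  "cdual_ract (f + g) a = cdual_ract f a + cdual_ract g a"
  "cdual_ract (c *\<^sub>C f) a = c *\<^sub>C cdual_ract f a"
  by (auto intro!: cdual_eqI simp: cdual_ract.rep_eq plus_cdual.rep_eq scaleC_cdual.rep_eq
      distrib_right mult_scaleC_left cdual_apply_add_arg cdual_apply_scaleC_arg)

lemma cdualI:
  assumes "\<And>x y. F (x + y) = F x + F y" "\<And>c x. F (c *\<^sub>C x) = c * F x"
    "\<And>x. cmod (F x) \<le> norm x * K"
  shows "bounded_linear F \<and> (\<forall>c x. F (c *\<^sub>C x) = c * F x)"
proof (intro conjI allI bounded_linear_intro)
  show "F (r *\<^sub>R x) = r *\<^sub>R F x" for r x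
    using assms(2)[of "complex_of_real r" x] by (simp add: scaleC_of_real scaleR_conv_of_real)
qed (use assms in auto)

lift_definition bidual_lact :: "'a :: cstar_algebra bidual \<Rightarrow> 'a cdual \<Rightarrow> 'a cdual"
  is "\<lambda>T f a. cdual_apply T (cdual_ract f a)"
proof (rule cdualI)
  fix T :: "'a bidual" and f :: "'a cdual" and a :: 'a
  have "cmod (T (cdual_ract f a)) \<le> norm T * norm (cdual_ract f a)"
    by (rule norm_cdual_apply_le)
  also have "\<dots> \<le> norm T * (norm f * norm a)"
    by (intro mult_left_mono norm_cdual_ract norm_ge_zero)
  finally show "cmod (T (cdual_ract f a)) \<le> norm a * (norm T * norm f)"
    by (simp add: mult_ac)
qed (simp_all add: cdual_ract_linear cdual_apply_add_arg cdual_apply_scaleC_arg)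

lemma norm_bidual_lact: "norm (bidual_lact T f) \<le> norm T * norm f"
proof (rule norm_cdual_le)
  fix a
  have "cmod (T (cdual_ract f a)) \<le> norm T * norm (cdual_ract f a)"
    by (rule norm_cdual_apply_le)
  also have "\<dots> \<le> norm T * (norm f * norm a)"
    by (intro mult_left_mono norm_cdual_ract norm_ge_zero)
  finally show "cmod (bidual_lact T f a) \<le> norm T * norm f * norm a"
    by (simp add: bidual_lact.rep_eq mult_ac)
qed simp

lift_definition arens_mult :: "'a :: cstar_algebra bidual \<Rightarrow> 'a bidual \<Rightarrow> 'a bidual"
    (infixl \<open>\<odot>\<close> 70)
  is "\<lambda>S T f. cdual_apply S (bidual_lact T f)"
proof (rule cdualI)
  fix S T :: "'a bidual" and f g :: "'a cdual" and c :: complex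
  show "S (bidual_lact T (f + g)) = S (bidual_lact T f) + S (bidual_lact T g)"
  proof -
    have "bidual_lact T (f + g) = bidual_lact T f + bidual_lact T g"
      by (rule cdual_eqI) (simp add: bidual_lact.rep_eq plus_cdual.rep_eq cdual_ract_linear
          cdual_apply_add_arg)
    then show ?thesis by (simp add: cdual_apply_add_arg)
  qed
  show "S (bidual_lact T (c *\<^sub>C f)) = c * S (bidual_lact T f)"
  proof -
    have "bidual_lact T (c *\<^sub>C f) = c *\<^sub>C bidual_lact T f"
      by (rule cdual_eqI) (simp add: bidual_lact.rep_eq scaleC_cdual.rep_eq cdual_ract_linear
          cdual_apply_scaleC_arg)
    then show ?thesis by (simp add: cdual_apply_scaleC_arg)
  qed
  have "cmod (S (bidual_lact T f)) \<le> norm S * norm (bidual_lact T f)"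
    by (rule norm_cdual_apply_le)
  also have "\<dots> \<le> norm S * (norm T * norm f)"
    by (intro mult_left_mono norm_bidual_lact norm_ge_zero)
  finally show "cmod (S (bidual_lact T f)) \<le> norm f * (norm S * norm T)"
    by (simp add: mult_ac)
qed

lemma to_bidual_mult: "to_bidual (a * b) = to_bidual a \<odot> to_bidual b"
  by (rule cdual_eqI) (simp add: to_bidual.rep_eq arens_mult.rep_eq bidual_lact.rep_eq
      cdual_ract.rep_eq)

lift_definition cdual_star :: "'a :: cstar_algebra cdual \<Rightarrow> 'a cdual"
  is "\<lambda>f a. cnj (f (star a))"
  by (auto intro!: bounded_linear_compose[OF bounded_linear_cnj]
      bounded_linear_compose[OF _ bounded_linear_star] simp: star_scaleC)

lemma norm_cdual_star: "norm (cdual_star f) \<le> norm f"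
proof (rule norm_cdual_le)
  show "cmod (cdual_star f a) \<le> norm f * norm a" for a
    using norm_cdual_apply_le[of f "star a"] by (simp add: cdual_star.rep_eq norm_star)
qed simp

lift_definition bidual_star :: "'a :: cstar_algebra bidual \<Rightarrow> 'a bidual"
  is "\<lambda>T f. cnj (cdual_apply T (cdual_star f))"
proof (rule cdualI)
  fix T :: "'a bidual" and f g :: "'a cdual" and c :: complex
  have "cdual_star (f + g) = cdual_star f + cdual_star g"
    by (rule cdual_eqI) (simp add: cdual_star.rep_eq plus_cdual.rep_eq)
  then show "cnj (T (cdual_star (f + g))) = cnj (T (cdual_star f)) + cnj (T (cdual_star g))"
    by (simp add: cdual_apply_add_arg)
  have "cdual_star (c *\<^sub>C f) = cnj c *\<^sub>C cdual_star f"
    by (rule cdual_eqI) (simp add: cdual_star.rep_eq scaleC_cdual.rep_eq)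
  then show "cnj (T (cdual_star (c *\<^sub>C f))) = c * cnj (T (cdual_star f))"
    by (simp add: cdual_apply_scaleC_arg)
  have "cmod (T (cdual_star f)) \<le> norm T * norm (cdual_star f)"
    by (rule norm_cdual_apply_le)
  also have "\<dots> \<le> norm T * norm f"
    by (intro mult_left_mono norm_cdual_star norm_ge_zero)
  finally show "cmod (cnj (T (cdual_star f))) \<le> norm f * norm T"
    by (simp add: mult.commute)
qed

lemma to_bidual_star: "to_bidual (star a) = bidual_star (to_bidual a)"
  by (rule cdual_eqI) (simp add: to_bidual.rep_eq bidual_star.rep_eq cdual_star.rep_eq)


section \<open>Multipliers\<close>

definition LM :: "'a :: cstar_algebra bidual set"
  where "LM = {T. \<forall>a. T \<odot> to_bidual a \<in> range to_bidual}"

definition RM :: "'a :: cstar_algebra bidual set"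
  where "RM = {T. \<forall>a. to_bidual a \<odot> T \<in> range to_bidual}"

definition M :: "'a :: cstar_algebra bidual set"
  where "M = LM \<inter> RM"

definition QM :: "'a :: cstar_algebra bidual set"
  where "QM = {T. \<forall>a b. to_bidual a \<odot> T \<odot> to_bidual b \<in> range to_bidual}"


section \<open>Hilbert C*-bimodules via their linking algebras\<close>

definition is_projection :: "'a :: cstar_algebra bidual \<Rightarrow> bool"
  where "is_projection p \<longleftrightarrow> p \<odot> p = p \<and> bidual_star p = p"

definition is_bidual_unit :: "'a :: cstar_algebra bidual \<Rightarrow> bool"
  where "is_bidual_unit e \<longleftrightarrow> (\<forall>T. e \<odot> T = T \<and> T \<odot> e = T)"

text \<open>\<open>corner p q\<close> is \<open>pLq\<close>, viewed as a subset of \<open>L\<close> itself; for \<open>p\<close> and \<open>q\<close> multipliers,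
  every product \<open>p \<odot> to_bidual l \<odot> q\<close> lies in \<open>range to_bidual\<close>.\<close>

definition corner :: "'l :: cstar_algebra bidual \<Rightarrow> 'l bidual \<Rightarrow> 'l set"
  where "corner p q = {x. \<exists>l. to_bidual x = p \<odot> to_bidual l \<odot> q}"

definition is_linear_isometry :: "('x :: complex_normed_vector \<Rightarrow> 'l :: complex_normed_vector) \<Rightarrow> bool"
  where "is_linear_isometry \<phi> \<longleftrightarrow> (\<forall>x y. \<phi> (x + y) = \<phi> x + \<phi> y) \<and>
    (\<forall>c x. \<phi> (c *\<^sub>C x) = c *\<^sub>C \<phi> x) \<and> (\<forall>x. norm (\<phi> x) = norm x)"

definition is_cstar_embedding :: "('a :: cstar_algebra \<Rightarrow> 'l :: cstar_algebra) \<Rightarrow> bool"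
  where "is_cstar_embedding \<phi> \<longleftrightarrow> is_linear_isometry \<phi> \<and>
    (\<forall>a b. \<phi> (a * b) = \<phi> a * \<phi> b) \<and> (\<forall>a. \<phi> (star a) = star (\<phi> a))"

text \<open>
  The type \<open>'x\<close> with module actions \<open>lact\<close>, \<open>ract\<close> and inner products \<open>lip\<close>, \<open>rip\<close> is an
  \<open>'a\<close>-\<open>'b\<close> Hilbert C*-bimodule with linking algebra \<open>'l\<close>; the maps \<open>iA\<close>, \<open>iB\<close>, \<open>iX\<close> are the
  identifications with the corners of \<open>'l\<close>.
\<close>

locale hilbert_cstar_bimodule =
  fixes lact :: "'a :: cstar_algebra \<Rightarrow> 'x :: complex_normed_vector \<Rightarrow> 'x"
    and ract :: "'x \<Rightarrow> 'b :: cstar_algebra \<Rightarrow> 'x"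
    and lip :: "'x \<Rightarrow> 'x \<Rightarrow> 'a"
    and rip :: "'x \<Rightarrow> 'x \<Rightarrow> 'b"
    and p q :: "'l :: cstar_algebra bidual"
    and iA :: "'a \<Rightarrow> 'l" and iB :: "'b \<Rightarrow> 'l" and iX :: "'x \<Rightarrow> 'l"
  assumes p_mult: "p \<in> M" and p_proj: "is_projection p"
    and q_mult: "q \<in> M" and q_proj: "is_projection q"
    and p_plus_q: "is_bidual_unit (p + q)"
    and iA: "is_cstar_embedding iA" and range_iA: "range iA = corner p p"
    and iB: "is_cstar_embedding iB" and range_iB: "range iB = corner q q"
    and iX: "is_linear_isometry iX" and range_iX: "range iX = corner p q"
    and iX_lact: "iX (lact a x) = iA a * iX x"
    and iX_ract: "iX (ract x b) = iX x * iB b"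
    and iA_lip: "iA (lip x y) = iX x * star (iX y)"
    and iB_rip: "iB (rip x y) = star (iX x) * iX y"

definition is_closed_ideal :: "'l :: cstar_algebra set \<Rightarrow> bool"
  where "is_closed_ideal I \<longleftrightarrow> closed I \<and> 0 \<in> I \<and> (\<forall>x\<in>I. \<forall>y\<in>I. x + y \<in> I) \<and>
    (\<forall>c. \<forall>x\<in>I. c *\<^sub>C x \<in> I) \<and> (\<forall>l. \<forall>x\<in>I. l * x \<in> I \<and> x * l \<in> I)"

definition closed_ideal_generated :: "'l :: cstar_algebra set \<Rightarrow> 'l set"
  where "closed_ideal_generated S = \<Inter> {I. is_closed_ideal I \<and> S \<subseteq> I}"

locale imprimitivity_bimodule = hilbert_cstar_bimodule +
  assumes A_full: "closed_ideal_generated (range iA) = UNIV"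
    and B_full: "closed_ideal_generated (range iB) = UNIV"

text \<open>Multipliers of the bimodule, as subsets of \<open>X\<^sup>*\<^sup>* = pL\<^sup>*\<^sup>*q\<close>.\<close>

definition LMX :: "'l :: cstar_algebra bidual \<Rightarrow> 'l bidual \<Rightarrow> 'l bidual set"
  where "LMX p q = (\<lambda>T. p \<odot> T \<odot> q) ` LM"

definition RMX :: "'l :: cstar_algebra bidual \<Rightarrow> 'l bidual \<Rightarrow> 'l bidual set"
  where "RMX p q = (\<lambda>T. p \<odot> T \<odot> q) ` RM"

definition MX :: "'l :: cstar_algebra bidual \<Rightarrow> 'l bidual \<Rightarrow> 'l bidual set"
  where "MX p q = (\<lambda>T. p \<odot> T \<odot> q) ` M"

definition QMX :: "'l :: cstar_algebra bidual \<Rightarrow> 'l bidual \<Rightarrow> 'l bidual set"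
  where "QMX p q = (\<lambda>T. p \<odot> T \<odot> q) ` QM"

end

theory Submission
  imports Defs
begin

text \<open>
  The engine is approximate factorization: every element \<open>a\<close> of a C*-algebra \<open>A\<close> lies in the
  closure of \<open>a a\<^sup>* A\<close> (\<open>approximate_factorization\<close>). The range of \<open>A\<close> in \<open>A\<^sup>*\<^sup>*\<close> is closed, so if
  \<open>T b c \<in> A\<close> for all \<open>b\<close> and \<open>c\<close>, then already \<open>T b \<in> A\<close> for all \<open>b\<close>. This upgrades information on
  products to information on single elements.

  For a quasi-multiplier \<open>T\<close> and \<open>b \<in> A\<close>, the element \<open>T b\<close> is a right multiplier. If right
  multipliers are left multipliers, then \<open>T b c \<in> A\<close> for all \<open>b\<close> and \<open>c\<close>, so \<open>T\<close> is a left multiplier.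
  Taking adjoints exchanges left and right, and this gives the statement on a single algebra. For a
  bimodule the same argument applies to \<open>p T b q\<close> instead of \<open>T b\<close>
  (\<open>QMX_eq_LMX_iff_RMX_subset_LMX\<close>), and the mirrored statement follows by exchanging \<open>p\<close> and \<open>q\<close>
  and taking adjoints.

  For imprimitivity bimodules, let \<open>L\<close> be the linking algebra and \<open>r\<close> one of \<open>p\<close>, \<open>q\<close>. For a
  quasi-multiplier \<open>T\<close> of \<open>L\<close>, the set of all \<open>k \<in> L\<close> with \<open>e T m k \<in> L\<close> for every \<open>m \<in> L\<close> is a closed
  two-sided ideal. If \<open>e S r\<close> is a left multiplier for every quasi-multiplier \<open>S\<close>, in particular for
  \<open>S = T m\<close>, then this ideal contains \<open>r L r\<close>; as \<open>r L r\<close> generates \<open>L\<close>, it is all of \<open>L\<close>, and \<open>e T\<close>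
  is a left multiplier (\<open>full_corner_LM\<close>). Hence, \<open>e QM(L) r \<subseteq> LM(L)\<close> is the same condition
  for \<open>r = p\<close> and for \<open>r = q\<close>, namely \<open>e QM(L) \<subseteq> LM(L)\<close>. With \<open>e = p\<close>, the case \<open>r = q\<close> says
  \<open>QM(X) = LM(X)\<close>, and the case \<open>r = p\<close> says \<open>QM(A) = M(A)\<close> because \<open>A\<close> is the corner \<open>p L p\<close>
  (\<open>QM_eq_M_iff_corner\<close>). Applying this to \<open>p\<close> and, through adjoints, to \<open>q\<close> and adding
  \<open>T = p T + q T\<close> settles \<open>QM(X) = M(X)\<close>.

  Two facts on \<open>L\<^sup>*\<^sup>*\<close> make the transfer between \<open>p\<close> and \<open>q\<close>, and between \<open>A\<close> and \<open>L\<close>, work: the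
  adjoint reverses products in which one factor is a multiplier, and \<open>T \<mapsto> p T p\<close> is the
  bitranspose of \<open>l \<mapsto> p l p\<close>. Both hold because elements of \<open>L\<^sup>*\<^sup>*\<close> are separated by
  multiplication with elements of \<open>L\<close>, where the products can be computed directly.
\<close>

section \<open>Approximate factorization in C*-algebras\<close>

instance cstar_algebra \<subseteq> banach ..

text \<open>
  Equivalently, \<open>1 + w\<close> is unitary in the unitization. Phrasing unitarity this way keeps all
  computations inside an algebra that may have no unit.
\<close>

definition quasi_unitary :: "'a :: cstar_algebra \<Rightarrow> bool"
  where "quasi_unitary w \<longleftrightarrow> w + star w + star w * w = 0 \<and> w + star w + w * star w = 0"

lemmas linear_star = bounded_linear.linear[OF bounded_linear_star]
lemmas star_diff = linear_diff[OF linear_star]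

lemma norm_mult_star_self: "norm (x * star x) = (norm (x :: 'a :: cstar_algebra))\<^sup>2"
  using cstar_identity[of "star x"] by (simp add: star_star norm_star)

lemma norm_quasi_unitary_le:
  fixes w :: "'a :: cstar_algebra"
  assumes "quasi_unitary w"
  shows "norm w \<le> 2"
proof -
  have "star w * w = - (w + star w)"
    using assms unfolding quasi_unitary_def by (metis add.commute eq_neg_iff_add_eq_0)
  then have "(norm w)\<^sup>2 = norm (w + star w)"
    by (metis cstar_identity norm_minus_cancel)
  also have "\<dots> \<le> 2 * norm w"
    using norm_triangle_ineq[of w "star w"] by (simp add: norm_star)
  finally have "norm w * norm w \<le> 2 * norm w"
    by (simp add: power2_eq_square)
  then show ?thesis
    by (cases "w = 0") auto
qed

lemma norm_mult_one_plus_quasi_unitary: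
  fixes w z :: "'a :: cstar_algebra"
  assumes "quasi_unitary w"
  shows "norm (z + z * w) = norm z"
proof -
  have "(z + z * w) * star (z + z * w) = z * star z + z * (w + star w + w * star w) * star z"
    by (simp add: star_add star_mult algebra_simps)
  also have "\<dots> = z * star z"
    using assms by (simp add: quasi_unitary_def)
  finally have "(norm (z + z * w))\<^sup>2 = (norm z)\<^sup>2"
    by (metis norm_mult_star_self)
  then show ?thesis
    by simp
qed

text \<open>
  Multiplication by \<open>1 + w/2 = (1 + (1 + w))/2\<close> is an average of two isometries.
\<close>

lemma norm_mult_half_quasi_unitary_le:
  fixes w z :: "'a :: cstar_algebra"
  assumes "quasi_unitary w"
  shows "norm (z + (1/2) *\<^sub>R (z * w)) \<le> norm z"
proof -
  have "z + (1/2) *\<^sub>R (z * w) = (1/2) *\<^sub>R (z + (z + z * w))"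
    by (simp add: algebra_simps flip: scaleR_add_left)
  also have "norm \<dots> \<le> (1/2) * (norm z + norm (z + z * w))"
    using norm_triangle_ineq[of z "z + z * w"] by simp
  finally show ?thesis
    by (simp add: norm_mult_one_plus_quasi_unitary[OF assms])
qed

text \<open>
  The square of the unitary \<open>1 + w\<close> is \<open>1 + (w + w + w\<^sup>2)\<close>.
\<close>

lemma quasi_unitary_square:
  fixes w :: "'a :: cstar_algebra"
  assumes "quasi_unitary w"
  shows "quasi_unitary (w + w + w * w)"
proof -
  let ?l = "w + star w + star w * w" and ?r = "w + star w + w * star w"
  have 0: "?l = 0" "?r = 0"
    using assms by (simp_all add: quasi_unitary_def)
  have "(w + w + w * w) + star (w + w + w * w) + star (w + w + w * w) * (w + w + w * w)
      = ?l + ?l + ?l * w + star w * ?l + star w * ?l * w"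
    by (simp add: star_add star_mult algebra_simps)
  moreover have "(w + w + w * w) + star (w + w + w * w) + (w + w + w * w) * star (w + w + w * w)
      = ?r + ?r + ?r * star w + w * ?r + w * ?r * star w"
    by (simp add: star_add star_mult algebra_simps)
  ultimately show ?thesis
    unfolding quasi_unitary_def 0 by simp
qed

text \<open>
  The element \<open>g\<close> is the geometric series \<open>u + u\<^sup>2 + \<dots>\<close>, so \<open>1 + g\<close> inverts \<open>1 - u\<close>. It is found as a fixed
  point of a contraction, and the commutator \<open>k = g u - u g\<close> vanishes because \<open>k = u k\<close>.
\<close>

lemma ex_quasi_inverse:
  fixes u :: "'a :: cstar_algebra"
  assumes "norm u < 1"
  shows "\<exists>g. g = u + u * g \<and> g = u + g * u"
proof -
  have "dist (u + u * x) (u + u * y) \<le> norm u * dist x y" for x y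
    using norm_mult_ineq[of u "x - y"] by (simp add: dist_norm right_diff_distrib)
  then obtain g where g: "u + u * g = g"
    using banach_fix_type[of "norm u" "\<lambda>x. u + u * x"] assms by auto
  let ?k = "g * u - u * g"
  have "?k = (u + u * g) * u - u * (u + u * g)"
    by (simp add: g)
  also have "\<dots> = u * ?k"
    by (simp add: algebra_simps)
  finally have k: "?k = u * ?k" .
  have "norm ?k \<le> norm u * norm ?k"
    by (subst k) (rule norm_mult_ineq)
  then have "(1 - norm u) * norm ?k \<le> 0"
    by (simp add: algebra_simps)
  with assms have "?k = 0"
    by (simp add: mult_le_0_iff)
  with g show ?thesis
    by (metis eq_iff_diff_eq_0)
qed

text \<open>
  For skew-adjoint \<open>u\<close>, the Cayley transform \<open>(1 + u) / (1 - u)\<close> is unitary, and it equals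
  \<open>1 + (g + g)\<close>.
\<close>

lemma quasi_unitary_cayley:
  fixes u :: "'a :: cstar_algebra"
  assumes u: "star u = - u" and g: "g = u + u * g" "g = u + g * u"
  shows "quasi_unitary (g + g)"
proof -
  have s: "star g * u = - u - star g" "u * star g = - u - star g"
  proof -
    have "star g = - u - star g * u"
      by (subst g(1)) (simp add: star_add star_mult u)
    then show "star g * u = - u - star g"
      by (metis add_diff_cancel_left' diff_add_cancel)
    have "star g = - u - u * star g"
      by (subst g(2)) (simp add: star_add star_mult u)
    then show "u * star g = - u - star g"
      by (metis add_diff_cancel_left' diff_add_cancel)
  qed
  have "star g * g = star g * u + star g * u * g"
    by (subst (2) g(1)) (simp only: distrib_left mult.assoc)
  also have "\<dots> = - (u + u * g) - star g - star g * g"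
    unfolding s by (simp add: algebra_simps)
  finally have 1: "star g * g = - g - star g - star g * g"
    by (simp only: g(1)[symmetric])
  have "g * star g = u * star g + g * (u * star g)"
    by (subst (1) g(2)) (simp only: distrib_right mult.assoc)
  also have "\<dots> = - (u + g * u) - star g - g * star g"
    unfolding s by (simp add: algebra_simps)
  finally have 2: "g * star g = - g - star g - g * star g"
    by (simp only: g(2)[symmetric])
  have "(g + g) + star (g + g) + star (g + g) * (g + g)
      = 2 *\<^sub>R (g + star g + star g * g + star g * g)"
    by (simp add: star_add algebra_simps scaleR_2)
  moreover have "(g + g) + star (g + g) + (g + g) * star (g + g)
      = 2 *\<^sub>R (g + star g + g * star g + g * star g)"
    by (simp add: star_add algebra_simps scaleR_2)
  moreover have "g + star g + star g * g + star g * g = 0"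
    by (subst (1) 1) simp
  moreover have "g + star g + g * star g + g * star g = 0"
    by (subst (1) 2) simp
  ultimately show ?thesis
    unfolding quasi_unitary_def by simp
qed

text \<open>
  Squaring a unitary \<open>1 + w\<close> roughly doubles the part of \<open>w\<close> that is linear in \<open>u\<close>, while \<open>norm w \<le> 2\<close>
  stays true. Starting from the Cayley transform, \<open>n\<close> squarings give \<open>w = 2 ^ Suc n (u - u e)\<close>, so
  \<open>u - u e\<close> has norm at most \<open>2 / 2 ^ Suc n\<close>. From one step to the next \<open>1 - e\<close> is multiplied by
  \<open>1 + w/2\<close>; hence, right multiplication by \<open>1 - e\<close> remains contractive. This uniform bound is
  what allows passing from \<open>a\<^sup>* a\<close> to \<open>a\<close> in the next result.
\<close>

lemma skew_approximate_unit:
  fixes u :: "'a :: cstar_algebra"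
  assumes u: "star u = - u" "norm u < 1"
  shows "\<exists>e t y. e = t *\<^sub>R u + u * y \<and> norm (u - u * e) \<le> (1/2) ^ n \<and>
    (\<forall>z. norm (z - z * e) \<le> norm z)"
proof -
  have "\<exists>w e t y. quasi_unitary w \<and> w = 2 ^ Suc n *\<^sub>R (u - u * e) \<and> e = t *\<^sub>R u + u * y \<and>
    (\<forall>z. norm (z - z * e) \<le> norm z)"
  proof (induction n)
    case 0
    obtain g where g: "g = u + u * g" "g = u + g * u"
      using ex_quasi_inverse[OF u(2)] by blast
    have q: "quasi_unitary (g + g)"
      by (rule quasi_unitary_cayley[OF u(1) g])
    show ?case
    proof (intro exI conjI allI)
      show "g + g = 2 ^ Suc 0 *\<^sub>R (u - u * - g)"
        by (simp add: g(1)[symmetric] flip: scaleR_2)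
      show "- g = (- 1) *\<^sub>R u + u * (- g)"
        using arg_cong[of _ _ uminus, OF g(1)[symmetric]] by simp
      show "norm (z - z * - g) \<le> norm z" for z
        using norm_mult_half_quasi_unitary_le[OF q, of z]
        by (simp add: distrib_left flip: scaleR_2)
    qed (rule q)
  next
    case (Suc n)
    then obtain w e t y where IH: "quasi_unitary w" "w = 2 ^ Suc n *\<^sub>R (u - u * e)"
        "e = t *\<^sub>R u + u * y" "\<And>z. norm (z - z * e) \<le> norm z"
      by blast
    \<comment> \<open>chosen so that \<open>1 - ?e = (1 - e) (1 + w/2)\<close>\<close>
    let ?e = "e - (1/2) *\<^sub>R w + (1/2) *\<^sub>R (e * w)"
    have z: "z - z * ?e = (z - z * e) + (1/2) *\<^sub>R ((z - z * e) * w)" for z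
      by (simp add: algebra_simps)
    show ?case
    proof (intro exI conjI allI)
      show "quasi_unitary (w + w + w * w)"
        by (rule quasi_unitary_square[OF IH(1)])
      have "2 ^ Suc (Suc n) *\<^sub>R (u - u * ?e)
          = 2 *\<^sub>R (2 ^ Suc n *\<^sub>R (u - u * e)) + (2 ^ Suc n *\<^sub>R (u - u * e)) * w"
        by (subst z) (simp add: scaleR_add_right)
      also have "\<dots> = w + w + w * w"
        by (simp only: IH(2)[symmetric] scaleR_2)
      finally show "w + w + w * w = 2 ^ Suc (Suc n) *\<^sub>R (u - u * ?e)" ..
      have "?e = (t *\<^sub>R u + u * y) - (2 ^ n) *\<^sub>R (u - u * e) + (1/2) *\<^sub>R ((t *\<^sub>R u + u * y) * w)"
        using IH(2) by (simp flip: IH(3))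
      also have "\<dots> = (t - 2 ^ n) *\<^sub>R u
          + u * (y + 2 ^ n *\<^sub>R e + (1/2) *\<^sub>R (t *\<^sub>R w + y * w))"
        by (simp add: algebra_simps)
      finally show "?e = (t - 2 ^ n) *\<^sub>R u
          + u * (y + 2 ^ n *\<^sub>R e + (1/2) *\<^sub>R (t *\<^sub>R w + y * w))" .
      show "norm (z - z * ?e) \<le> norm z" for z
        unfolding z
        using norm_mult_half_quasi_unitary_le[OF IH(1), of "z - z * e"] IH(4)[of z] by linarith
    qed
  qed
  then obtain w e t y where *: "quasi_unitary w" "w = 2 ^ Suc n *\<^sub>R (u - u * e)"
      "e = t *\<^sub>R u + u * y" "\<And>z. norm (z - z * e) \<le> norm z"
    by blast
  have "2 ^ Suc n * norm (u - u * e) \<le> 2"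
    using norm_quasi_unitary_le[OF *(1)] unfolding *(2) by simp
  then have "norm (u - u * e) \<le> (1/2) ^ n"
    by (simp add: field_simps)
  then show ?thesis
    by (intro exI conjI allI) (rule *(3), assumption, rule *(4))
qed

lemma scaleC_minus_left: "(- c) *\<^sub>C x = - (c *\<^sub>C x)"
  using scaleC_add_left[of "- c" c x] scaleC_of_real[of 0 x] by (simp add: eq_neg_iff_add_eq_0)

lemma scaleC_diff_right: "c *\<^sub>C (x - y) = c *\<^sub>C x - c *\<^sub>C y"
  using scaleC_add_right[of c "x - y" y] by (simp add: algebra_simps)

text \<open>
  Take \<open>e\<close> from the preceding lemma for the skew-adjoint element \<open>u = i s a\<^sup>* a\<close>, where the scalar \<open>s\<close>
  makes \<open>norm u < 1\<close>. By the C*-identity and contractivity of \<open>1 - e\<close>, the square of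
  \<open>norm (a - a e)\<close> is at most the norm of \<open>a\<^sup>* a - a\<^sup>* a e\<close>. As \<open>e\<close> is a combination of \<open>u\<close> and
  \<open>u y\<close>, the product \<open>a e\<close> starts with \<open>a a\<^sup>*\<close>.
\<close>

proposition approximate_factorization:
  fixes a :: "'a :: cstar_algebra"
  assumes "\<epsilon> > 0"
  shows "\<exists>z. norm (a - a * star a * z) < \<epsilon>"
proof -
  define x where "x = star a * a"
  \<comment> \<open>the summand 1 makes \<open>s * norm x\<close> strictly less than 1 and covers \<open>x = 0\<close>\<close>
  define s where "s = inverse (norm x + 1)"
  have s: "s > 0" "s * norm x < 1"
    by (simp_all add: s_def inverse_eq_divide add_nonneg_pos divide_less_eq_1)
  define u where "u = (\<i> * complex_of_real s) *\<^sub>C x"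
  have "star x = x"
    by (simp add: x_def star_mult star_star)
  then have "star u = - u"
    by (simp add: u_def star_scaleC scaleC_minus_left)
  moreover have "norm u < 1"
    using s by (simp add: u_def norm_scaleC norm_mult)
  ultimately have ex: "\<exists>e t y. e = t *\<^sub>R u + u * y \<and> norm (u - u * e) \<le> (1/2) ^ n \<and>
      (\<forall>z. norm (z - z * e) \<le> norm z)" for n
    by (rule skew_approximate_unit)
  obtain n where n: "(1/2 :: real) ^ n < s * \<epsilon>\<^sup>2"
    using real_arch_pow_inv[of "s * \<epsilon>\<^sup>2" "1/2"] s assms by auto
  obtain e t y where e: "e = t *\<^sub>R u + u * y" "norm (u - u * e) \<le> (1/2) ^ n"
      "\<And>z. norm (z - z * e) \<le> norm z"
    using ex[of n] by blast
  have "u - u * e = (\<i> * complex_of_real s) *\<^sub>C (x - x * e)"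
    by (simp add: u_def mult_scaleC_left scaleC_diff_right)
  then have *: "s * norm (x - x * e) \<le> (1/2) ^ n"
    using e(2) s by (simp add: norm_scaleC norm_mult)
  let ?v = "star (x - x * e)"
  have "star (a - a * e) * (a - a * e) = star (?v - ?v * e)"
    by (simp add: star_diff star_mult star_star star_add x_def algebra_simps)
  then have "(norm (a - a * e))\<^sup>2 = norm (?v - ?v * e)"
    by (metis cstar_identity norm_star)
  also have "\<dots> \<le> norm (x - x * e)"
    using e(3)[of ?v] by (simp add: norm_star)
  finally have "s * (norm (a - a * e))\<^sup>2 < s * \<epsilon>\<^sup>2"
    using * n s(1) by (smt (verit) mult_left_mono)
  then have "norm (a - a * e) < \<epsilon>"
    using s(1) assms by (simp add: power2_less_imp_less)
  moreover have "a * e = a * star a * ((\<i> * complex_of_real s) *\<^sub>C (t *\<^sub>R a + a * y))"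
    by (simp add: e(1) u_def x_def mult_scaleC_right mult_scaleC_left scaleC_add_right
        distrib_left mult.assoc flip: scaleC_of_real)
       (simp add: scaleC_scaleC mult.commute)
  ultimately show ?thesis
    by metis
qed

lemma approximate_factorization_left:
  fixes a :: "'a :: cstar_algebra"
  assumes "\<epsilon> > 0"
  shows "\<exists>z. norm (a - z * star a * a) < \<epsilon>"
proof -
  obtain z where z: "norm (star a - star a * star (star a) * z) < \<epsilon>"
    using approximate_factorization[OF assms] by blast
  have "star (star a - star a * star (star a) * z) = a - star z * star a * a"
    by (simp add: star_diff star_mult star_star mult.assoc)
  with z have "norm (a - star z * star a * a) < \<epsilon>"
    using norm_star[of "star a - star a * star (star a) * z"] by simp
  then show ?thesis
    by blast
qed

lemma closed_contains_by_factorization: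
  fixes a :: "'a :: cstar_algebra"
  assumes "closed S" "\<And>z. a * star a * z \<in> S"
  shows "a \<in> S"
proof -
  have "\<exists>l\<in>S. dist l a < \<epsilon>" if "\<epsilon> > 0" for \<epsilon>
    using approximate_factorization[OF that, of a] assms(2) by (auto simp: dist_norm norm_minus_commute)
  then show ?thesis
    using closed_approachable[OF assms(1)] by blast
qed

lemma closed_contains_by_factorization_left:
  fixes a :: "'a :: cstar_algebra"
  assumes "closed S" "\<And>z. z * star a * a \<in> S"
  shows "a \<in> S"
proof -
  have "\<exists>l\<in>S. dist l a < \<epsilon>" if "\<epsilon> > 0" for \<epsilon>
    using approximate_factorization_left[OF that, of a] assms(2) by (auto simp: dist_norm norm_minus_commute)
  then show ?thesis
    using closed_approachable[OF assms(1)] by blast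
qed

section \<open>The Hahn-Banach theorem and the embedding into the bidual\<close>

definition sublinear :: "('a :: real_vector \<Rightarrow> real) \<Rightarrow> bool"
  where "sublinear s \<longleftrightarrow> (\<forall>x y. s (x + y) \<le> s x + s y) \<and> (\<forall>r>0. \<forall>x. s (r *\<^sub>R x) \<le> r * s x)"

lemma sublinear_scaleR:
  assumes "sublinear s" "r \<ge> 0"
  shows "s (r *\<^sub>R x) = r * s x"
proof (cases "r = 0")
  case True
  have "s (r *\<^sub>R 0) \<le> r * s 0" if "r > 0" for r
    using assms(1) that unfolding sublinear_def by blast
  from this[of 2] this[of "1/2"] True show ?thesis
    by simp
next
  case False
  then have "s (inverse r *\<^sub>R (r *\<^sub>R x)) \<le> inverse r * s (r *\<^sub>R x)"
    using assms unfolding sublinear_def by (simp del: scaleR_scaleR)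
  then have "s x \<le> inverse r * s (r *\<^sub>R x)"
    using False by simp
  moreover have "s (r *\<^sub>R x) \<le> r * s x"
    using False assms unfolding sublinear_def by auto
  ultimately show ?thesis
    using False assms(2) by (simp add: field_simps)
qed

lemma sublinear_lower_bound: "sublinear s \<Longrightarrow> - s (- x) \<le> s x"
proof -
  assume s: "sublinear s"
  have "s (x + - x) \<le> s x + s (- x)"
    using s unfolding sublinear_def by blast
  then show ?thesis
    using sublinear_scaleR[OF s, of 0 0] by simp
qed

text \<open>
  The largest sublinear functional below \<open>s\<close> whose value at \<open>- y\<close> is at most \<open>- s y\<close>.
\<close>

definition sublinear_shift :: "('a :: real_vector \<Rightarrow> real) \<Rightarrow> 'a \<Rightarrow> 'a \<Rightarrow> real"
  where "sublinear_shift s y x = (INF t\<in>{0..}. s (x + t *\<^sub>R y) - t * s y)"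

lemma sublinear_shift_le:
  assumes "sublinear s" "t \<ge> 0"
  shows "sublinear_shift s y x \<le> s (x + t *\<^sub>R y) - t * s y"
  unfolding sublinear_shift_def
proof (rule cINF_lower)
  have "- s (- x) \<le> s (x + t *\<^sub>R y) - t * s y" if "t \<ge> 0" for t
  proof -
    have "s ((x + t *\<^sub>R y) + - x) \<le> s (x + t *\<^sub>R y) + s (- x)"
      using assms(1) unfolding sublinear_def by blast
    then show ?thesis
      using sublinear_scaleR[OF assms(1) that, of y] by simp
  qed
  then show "bdd_below ((\<lambda>t. s (x + t *\<^sub>R y) - t * s y) ` {0..})"
    by (intro bdd_belowI2) auto
qed (use assms in simp)

lemma sublinear_shift_greatest:
  assumes "\<And>t. t \<ge> 0 \<Longrightarrow> c \<le> s (x + t *\<^sub>R y) - t * s y"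
  shows "c \<le> sublinear_shift s y x"
  unfolding sublinear_shift_def by (rule cINF_greatest) (use assms in auto)

lemma sublinear_sublinear_shift:
  assumes s: "sublinear s"
  shows "sublinear (sublinear_shift s y)"
  unfolding sublinear_def
proof (intro conjI allI impI)
  fix x x'
  have le: "sublinear_shift s y (x + x') - (s (x + t *\<^sub>R y) - t * s y) \<le> s (x' + t' *\<^sub>R y) - t' * s y"
    if "t \<ge> 0" "t' \<ge> 0" for t t'
  proof -
    have "sublinear_shift s y (x + x') \<le> s ((x + x') + (t + t') *\<^sub>R y) - (t + t') * s y"
      using that by (intro sublinear_shift_le[OF s]) auto
    also have "(x + x') + (t + t') *\<^sub>R y = (x + t *\<^sub>R y) + (x' + t' *\<^sub>R y)"
      by (simp add: algebra_simps)
    also have "s \<dots> \<le> s (x + t *\<^sub>R y) + s (x' + t' *\<^sub>R y)"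
      using s unfolding sublinear_def by blast
    finally show ?thesis
      by (simp add: algebra_simps)
  qed
  have "sublinear_shift s y (x + x') - sublinear_shift s y x' \<le> s (x + t *\<^sub>R y) - t * s y"
    if "t \<ge> 0" for t
    using sublinear_shift_greatest[of _ s x' y, OF le[OF that]] by (simp add: algebra_simps)
  from sublinear_shift_greatest[of _ s x y, OF this]
  show "sublinear_shift s y (x + x') \<le> sublinear_shift s y x + sublinear_shift s y x'"
    by simp
next
  fix r :: real and x assume "r > 0"
  have "inverse r * sublinear_shift s y (r *\<^sub>R x) \<le> s (x + t *\<^sub>R y) - t * s y" if "t \<ge> 0" for t
  proof -
    have "sublinear_shift s y (r *\<^sub>R x) \<le> s (r *\<^sub>R x + (r * t) *\<^sub>R y) - (r * t) * s y"
      using that \<open>r > 0\<close> by (intro sublinear_shift_le[OF s]) auto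
    also have "r *\<^sub>R x + (r * t) *\<^sub>R y = r *\<^sub>R (x + t *\<^sub>R y)"
      by (simp add: algebra_simps)
    also have "s \<dots> = r * s (x + t *\<^sub>R y)"
      using \<open>r > 0\<close> by (intro sublinear_scaleR[OF s]) auto
    finally show ?thesis
      using \<open>r > 0\<close> by (simp add: field_simps)
  qed
  from sublinear_shift_greatest[of _ s x y, OF this]
  show "sublinear_shift s y (r *\<^sub>R x) \<le> r * sublinear_shift s y x"
    using \<open>r > 0\<close> by (simp add: field_simps)
qed

text \<open>
  The infimum is finite because every \<open>s \<in> C\<close> satisfies \<open>- p (- x) \<le> s x\<close>. Subadditivity uses the chain
  property: two members bounding \<open>s x\<close> and \<open>s y\<close> separately can be replaced by the smaller one.
\<close>

lemma sublinear_INF_chain: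
  assumes C: "C \<noteq> {}" "\<And>s. s \<in> C \<Longrightarrow> sublinear s" "\<And>s. s \<in> C \<Longrightarrow> s \<le> p"
    and chain: "\<And>s s'. s \<in> C \<Longrightarrow> s' \<in> C \<Longrightarrow> s \<le> s' \<or> s' \<le> s"
  shows "sublinear (\<lambda>x. INF s\<in>C. s x)" "\<And>s. s \<in> C \<Longrightarrow> (\<lambda>x. INF s\<in>C. s x) \<le> s"
proof -
  have lower: "(INF s\<in>C. s x) \<le> s x" if "s \<in> C" for s x
  proof (rule cINF_lower[OF _ that])
    show "bdd_below ((\<lambda>s. s x) ` C)"
    proof (rule bdd_belowI2)
      fix s assume "s \<in> C"
      then have "- s (- x) \<le> s x" "s (- x) \<le> p (- x)"
        using sublinear_lower_bound C(2) le_funD[OF C(3)] by auto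
      then show "- p (- x) \<le> s x"
        by linarith
    qed
  qed
  show "(\<lambda>x. INF s\<in>C. s x) \<le> s" if "s \<in> C" for s
    using lower[OF that] by (simp add: le_fun_def)
  show "sublinear (\<lambda>x. INF s\<in>C. s x)"
    unfolding sublinear_def
  proof (intro conjI allI impI)
    fix x y
    have le: "(INF s\<in>C. s (x + y)) - s x \<le> s' y" if "s \<in> C" "s' \<in> C" for s s'
    proof -
      have "\<exists>r\<in>C. r \<le> s \<and> r \<le> s'"
        using chain[OF that] that by auto
      then obtain r where r: "r \<in> C" "r \<le> s" "r \<le> s'"
        by blast
      have "(INF s\<in>C. s (x + y)) \<le> r (x + y)"
        by (rule lower[OF r(1)])
      also have "\<dots> \<le> r x + r y"
        using C(2)[OF r(1)] unfolding sublinear_def by blast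
      also have "\<dots> \<le> s x + s' y"
        using r by (intro add_mono) (auto simp: le_fun_def)
      finally show ?thesis
        by simp
    qed
    have "(INF s\<in>C. s (x + y)) - s x \<le> (INF s\<in>C. s y)" if "s \<in> C" for s
      by (rule cINF_greatest[OF C(1)]) (rule le[OF that])
    then have "(INF s\<in>C. s (x + y)) - (INF s\<in>C. s y) \<le> s x" if "s \<in> C" for s
      using that by (simp add: algebra_simps)
    then have "(INF s\<in>C. s (x + y)) - (INF s\<in>C. s y) \<le> (INF s\<in>C. s x)"
      by (intro cINF_greatest[OF C(1)])
    then show "(INF s\<in>C. s (x + y)) \<le> (INF s\<in>C. s x) + (INF s\<in>C. s y)"
      by simp
  next
    fix r :: real and x assume "r > 0"
    have "inverse r * (INF s\<in>C. s (r *\<^sub>R x)) \<le> s x" if "s \<in> C" for s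
      using lower[OF that, of "r *\<^sub>R x"] sublinear_scaleR[OF C(2)[OF that], of r x] \<open>r > 0\<close>
      by (simp add: field_simps)
    then have "inverse r * (INF s\<in>C. s (r *\<^sub>R x)) \<le> (INF s\<in>C. s x)"
      by (intro cINF_greatest[OF C(1)])
    then show "(INF s\<in>C. s (r *\<^sub>R x)) \<le> r * (INF s\<in>C. s x)"
      using \<open>r > 0\<close> by (simp add: field_simps)
  qed
qed

text \<open>
  By Zorn's lemma there is a minimal sublinear functional \<open>m \<le> p\<close>. Minimality forces
  \<open>sublinear_shift m y = m\<close> for all \<open>y\<close>, and this says that \<open>m\<close> is superadditive; hence, \<open>m\<close> is linear.
\<close>

theorem Hahn_Banach_dominated:
  assumes p: "sublinear p"
  shows "\<exists>f. linear f \<and> f \<le> p"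
proof -
  let ?A = "{s. sublinear s \<and> s \<le> p}"
  have "\<exists>m\<in>?A. \<forall>s\<in>?A. m \<ge> s \<longrightarrow> s = m"
  proof (rule predicate_Zorn)
    show "partial_order_on ?A (relation_of (\<ge>) ?A)"
      by (auto simp: partial_order_on_def preorder_on_def refl_on_def trans_def antisym_def
          relation_of_def)
    fix C assume C: "C \<in> Chains (relation_of (\<ge>) ?A)"
    have sub: "sublinear s" "s \<le> p" if "s \<in> C" for s
      using C that by (auto simp: Chains_def relation_of_def)
    have chain: "s \<le> s' \<or> s' \<le> s" if "s \<in> C" "s' \<in> C" for s s'
      using C that by (auto simp: Chains_def relation_of_def)
    show "\<exists>u\<in>?A. \<forall>s\<in>C. s \<ge> u"
    proof (cases "C = {}")
      case True
      with p show ?thesis by auto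
    next
      case False
      note * = sublinear_INF_chain[OF False sub chain]
      then show ?thesis
        using False sub(2) by (intro bexI[of _ "\<lambda>x. INF s\<in>C. s x"]) (auto intro: order_trans)
    qed
  qed
  then obtain m where m: "sublinear m" "m \<le> p" and min: "\<And>s. sublinear s \<Longrightarrow> s \<le> m \<Longrightarrow> s = m"
    by (auto intro: order_trans)
  have superadd: "m x + m y \<le> m (x + y)" for x y
  proof -
    have "sublinear_shift m y = m"
      using sublinear_shift_le[OF m(1), of 0 y]
      by (intro min sublinear_sublinear_shift m) (auto simp: le_fun_def)
    then show ?thesis
      using sublinear_shift_le[OF m(1), of 1 y x] by simp
  qed
  then have add: "m (x + y) = m x + m y" for x y
    using m(1) unfolding sublinear_def by (meson order_antisym)
  have "m 0 = 0"
    using add[of 0 0] by simp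
  then have neg: "m (- x) = - m x" for x
    using add[of x "- x"] by simp
  have scale: "m (r *\<^sub>R x) = r * m x" for r x
  proof (cases "r \<ge> 0")
    case False
    then have "m ((- r) *\<^sub>R x) = - r * m x"
      by (intro sublinear_scaleR[OF m(1)]) auto
    then show ?thesis
      by (simp add: neg)
  qed (rule sublinear_scaleR[OF m(1)])
  have "linear m"
    by (rule linearI) (simp_all add: add scale)
  with m(2) show ?thesis
    by blast
qed

text \<open>
  A linear functional below \<open>sublinear_shift norm a\<close> is dominated by the norm and is at least \<open>norm a\<close>
  at \<open>a\<close>. It is the real part of a complex functional, and multiplying the argument by a phase
  shows that the complex functional obeys the same bound.
\<close>

lemma ex_norming_cdual:
  fixes a :: "'a :: complex_normed_vector"
  shows "\<exists>f. norm f \<le> 1 \<and> norm a \<le> cmod (cdual_apply f a)"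
proof -
  have norm: "sublinear (norm :: 'a \<Rightarrow> real)"
    by (simp add: sublinear_def norm_triangle_ineq)
  let ?p = "sublinear_shift norm a"
  obtain f where f: "linear f" "f \<le> ?p"
    using Hahn_Banach_dominated[OF sublinear_sublinear_shift[OF norm]] by blast
  have le: "f x \<le> norm x" for x
    using sublinear_shift_le[OF norm, of 0 a x] f(2) by (auto simp: le_fun_def intro: order_trans)
  have "f (- a) \<le> - norm a"
    using sublinear_shift_le[OF norm, of 1 a "- a"] f(2) by (auto simp: le_fun_def intro: order_trans)
  then have fa: "norm a \<le> f a"
    using linear_neg[OF f(1), of a] by simp
  \<comment> \<open>the complex linear functional with real part \<open>f\<close>\<close>
  define F where "F x = Complex (f x) (- f (\<i> *\<^sub>C x))" for x
  have F_add: "F (x + y) = F x + F y" for x y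
    by (simp add: F_def linear_add[OF f(1)] scaleC_add_right complex_eq_iff)
  have F_scale: "F (c *\<^sub>C x) = c * F x" for c x
  proof -
    have split: "f (c *\<^sub>C x) = Re c * f x + Im c * f (\<i> *\<^sub>C x)" for c x
    proof -
      have "c *\<^sub>C x = Re c *\<^sub>R x + Im c *\<^sub>R (\<i> *\<^sub>C x)"
        by (subst complex_eq) (simp only: scaleC_add_left scaleC_of_real[symmetric] scaleC_scaleC
            mult.commute)
      then show ?thesis
        by (simp add: linear_add[OF f(1)] linear_scale[OF f(1)])
    qed
    show ?thesis
      using split[of c x] split[of "\<i> * c" x]
      by (simp add: F_def complex_eq_iff scaleC_scaleC algebra_simps)
  qed
  have F_le: "cmod (F x) \<le> norm x" for x
  proof (cases "F x = 0")
    case False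
    define c where "c = complex_of_real (cmod (F x)) / F x"
    have c: "cmod c = 1" "c * F x = complex_of_real (cmod (F x))"
      using False by (simp_all add: c_def norm_divide)
    have "cmod (F x) = Re (F (c *\<^sub>C x))"
      by (simp add: F_scale c)
    also have "\<dots> \<le> norm (c *\<^sub>C x)"
      using le by (simp add: F_def)
    finally show ?thesis
      by (simp add: norm_scaleC c)
  qed simp
  have "bounded_linear F \<and> (\<forall>c x. F (c *\<^sub>C x) = c * F x)"
  proof (intro conjI allI bounded_linear_intro[of F 1])
    show "F (r *\<^sub>R x) = r *\<^sub>R F x" for r x
      using F_scale[of "complex_of_real r" x] by (simp add: scaleC_of_real scaleR_conv_of_real)
  qed (simp_all add: F_add F_scale F_le)
  then have F: "cdual_apply (Cdual F) = F"
    by (simp add: Cdual_inverse)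
  have "norm (Cdual F) \<le> 1"
    by (rule norm_cdual_le) (simp_all add: F F_le)
  moreover have "norm a \<le> cmod (F a)"
    using fa abs_Re_le_cmod[of "F a"] by (simp add: F_def)
  ultimately show ?thesis
    by (intro exI[of _ "Cdual F"]) (simp add: F)
qed

lemma norm_to_bidual: "norm (to_bidual a) = norm a"
proof (rule order_antisym)
  show "norm (to_bidual a) \<le> norm a"
    using norm_cdual_apply_le[of _ a] by (intro norm_cdual_le) (simp_all add: to_bidual.rep_eq mult.commute)
  obtain f where f: "norm f \<le> 1" "norm a \<le> cmod (cdual_apply f a)"
    using ex_norming_cdual by blast
  have "norm a \<le> norm (to_bidual a) * norm f"
    using f(2) norm_cdual_apply_le[of "to_bidual a" f] by (simp add: to_bidual.rep_eq)
  also have "\<dots> \<le> norm (to_bidual a) * 1"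
    by (intro mult_left_mono f) simp
  finally show "norm a \<le> norm (to_bidual a)"
    by simp
qed

lemma to_bidual_add: "to_bidual (a + b) = to_bidual a + to_bidual b"
  by (rule cdual_eqI) (simp add: to_bidual.rep_eq plus_cdual.rep_eq cdual_apply_add_arg)

lemma to_bidual_scaleC: "to_bidual (c *\<^sub>C a) = c *\<^sub>C to_bidual a"
  by (rule cdual_eqI) (simp add: to_bidual.rep_eq scaleC_cdual.rep_eq cdual_apply_scaleC_arg)

lemma bounded_linear_to_bidual: "bounded_linear to_bidual"
proof (rule bounded_linear_intro[of _ 1])
  show "to_bidual (r *\<^sub>R a) = r *\<^sub>R to_bidual a" for r and a :: 'a
    using to_bidual_scaleC[of "complex_of_real r" a] by (simp add: scaleC_of_real)
qed (simp_all add: to_bidual_add norm_to_bidual)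

lemma inj_to_bidual: "inj to_bidual"
proof (rule injI)
  fix a b :: 'a assume "to_bidual a = to_bidual b"
  then have "to_bidual (a - b) = 0"
    by (simp add: linear_diff[OF bounded_linear.linear[OF bounded_linear_to_bidual]])
  then show "a = b"
    by (metis norm_to_bidual norm_zero norm_eq_zero eq_iff_diff_eq_0)
qed

lemma closed_range_to_bidual: "closed (range (to_bidual :: 'a :: cstar_algebra \<Rightarrow> _))"
proof (rule complete_imp_closed, rule complete_isometric_image[of 1])
  show "complete (UNIV :: 'a set)"
    by (rule complete_UNIV)
qed (simp_all add: norm_to_bidual bounded_linear_to_bidual)

section \<open>The Arens product\<close>

lemma arens_apply: "cdual_apply (S \<odot> T) f = cdual_apply S (bidual_lact T f)"
  by (simp add: arens_mult.rep_eq)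

lemma bidual_lact_apply: "cdual_apply (bidual_lact T f) a = cdual_apply T (cdual_ract f a)"
  by (simp add: bidual_lact.rep_eq)

lemma cdual_ract_mult: "cdual_ract (cdual_ract f a) b = cdual_ract f (a * b)"
  by (rule cdual_eqI) (simp add: cdual_ract.rep_eq mult.assoc)

lemma arens_assoc: "(R \<odot> S) \<odot> T = R \<odot> (S \<odot> T)"
proof -
  have "bidual_lact S (bidual_lact T f) = bidual_lact (S \<odot> T) f" for f
  proof (rule cdual_eqI)
    fix a
    have "cdual_ract (bidual_lact T f) a = bidual_lact T (cdual_ract f a)"
      by (rule cdual_eqI, simp add: bidual_lact_apply cdual_ract.rep_eq[of _ a] cdual_ract_mult)
    then show "cdual_apply (bidual_lact S (bidual_lact T f)) a = cdual_apply (bidual_lact (S \<odot> T) f) a"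
      by (simp add: bidual_lact_apply arens_apply)
  qed
  then show ?thesis
    by (intro cdual_eqI) (simp add: arens_apply)
qed

lemma arens_add_left: "(S + T) \<odot> R = S \<odot> R + T \<odot> R"
  by (rule cdual_eqI) (simp add: arens_apply plus_cdual.rep_eq)

lemma arens_add_right: "R \<odot> (S + T) = R \<odot> S + R \<odot> T"
proof (rule cdual_eqI)
  fix f
  have "bidual_lact (S + T) f = bidual_lact S f + bidual_lact T f"
    by (rule cdual_eqI) (simp add: bidual_lact_apply plus_cdual.rep_eq)
  then show "cdual_apply (R \<odot> (S + T)) f = cdual_apply (R \<odot> S + R \<odot> T) f"
    by (simp add: arens_apply plus_cdual.rep_eq cdual_apply_add_arg)
qed

lemma arens_scaleC_left: "(c *\<^sub>C S) \<odot> R = c *\<^sub>C (S \<odot> R)"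
  by (rule cdual_eqI) (simp add: arens_apply scaleC_cdual.rep_eq)

lemma arens_scaleC_right: "R \<odot> (c *\<^sub>C S) = c *\<^sub>C (R \<odot> S)"
proof (rule cdual_eqI)
  fix f
  have "bidual_lact (c *\<^sub>C S) f = c *\<^sub>C bidual_lact S f"
    by (rule cdual_eqI) (simp add: bidual_lact_apply scaleC_cdual.rep_eq)
  then show "cdual_apply (R \<odot> (c *\<^sub>C S)) f = cdual_apply (c *\<^sub>C (R \<odot> S)) f"
    by (simp add: arens_apply scaleC_cdual.rep_eq cdual_apply_scaleC_arg)
qed

lemma norm_arens: "norm (S \<odot> T) \<le> norm S * norm T"
proof (rule norm_cdual_le)
  fix f
  have "cmod (cdual_apply (S \<odot> T) f) \<le> norm S * norm (bidual_lact T f)"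
    unfolding arens_apply by (rule norm_cdual_apply_le)
  also have "\<dots> \<le> norm S * (norm T * norm f)"
    by (intro mult_left_mono norm_bidual_lact norm_ge_zero)
  finally show "cmod (cdual_apply (S \<odot> T) f) \<le> norm S * norm T * norm f"
    by (simp add: mult.assoc)
qed simp

lemma arens_scaleR:
  "(r *\<^sub>R S) \<odot> R = r *\<^sub>R (S \<odot> R)" "R \<odot> (r *\<^sub>R S) = r *\<^sub>R (R \<odot> S)"
  by (metis arens_scaleC_left scaleC_of_real, metis arens_scaleC_right scaleC_of_real)

lemma bounded_linear_arens_right: "bounded_linear (\<lambda>a. R \<odot> to_bidual a)"
proof (rule bounded_linear_compose[OF _ bounded_linear_to_bidual])
  show "bounded_linear (\<lambda>S. R \<odot> S)"
  proof (rule bounded_linear_intro[of _ "norm R"])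
    show "norm (R \<odot> S) \<le> norm S * norm R" for S
      using norm_arens[of R S] by (simp add: mult.commute)
  qed (simp_all add: arens_add_right arens_scaleR)
qed

lemma bounded_linear_arens_left: "bounded_linear (\<lambda>a. to_bidual a \<odot> R)"
proof (rule bounded_linear_compose[OF _ bounded_linear_to_bidual])
  show "bounded_linear (\<lambda>S. S \<odot> R)"
    by (rule bounded_linear_intro[of _ "norm R"])
      (simp_all add: arens_add_left arens_scaleR norm_arens)
qed

lemma to_bidual_arens_apply: "cdual_apply (to_bidual a \<odot> T) f = cdual_apply T (cdual_ract f a)"
  by (simp add: arens_apply to_bidual.rep_eq bidual_lact_apply)

lemma bidual_lact_to_bidual_apply: "cdual_apply (bidual_lact (to_bidual b) f) a = cdual_apply f (a * b)"
  by (simp add: bidual_lact_apply to_bidual.rep_eq cdual_ract.rep_eq)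

lemma bidual_star_star: "bidual_star (bidual_star T) = T"
proof -
  have "cdual_star (cdual_star f) = f" for f :: "'a cdual"
    by (rule cdual_eqI) (simp add: cdual_star.rep_eq star_star)
  then show ?thesis
    by (intro cdual_eqI) (simp add: bidual_star.rep_eq)
qed

text \<open>
  With a factor in \<open>A\<close> the adjoint reverses the product by direct computation. For multipliers this
  is extended in \<open>bidual_star_arens_left\<close>.
\<close>

lemma bidual_star_arens_to_bidual:
  "bidual_star (T \<odot> to_bidual b) = to_bidual (star b) \<odot> bidual_star T"
proof (rule cdual_eqI)
  fix f
  have "cdual_star (cdual_ract f (star b)) = bidual_lact (to_bidual b) (cdual_star f)"
    by (rule cdual_eqI)
      (simp add: cdual_star.rep_eq cdual_ract.rep_eq bidual_lact_to_bidual_apply star_mult)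
  then show "cdual_apply (bidual_star (T \<odot> to_bidual b)) f
      = cdual_apply (to_bidual (star b) \<odot> bidual_star T) f"
    by (simp add: to_bidual_arens_apply bidual_star.rep_eq arens_apply[of T])
qed

lemma bidual_star_to_bidual_arens:
  "bidual_star (to_bidual a \<odot> T) = bidual_star T \<odot> to_bidual (star a)"
proof -
  have "to_bidual a \<odot> T = bidual_star (bidual_star T \<odot> to_bidual (star a))"
    by (simp add: bidual_star_arens_to_bidual bidual_star_star star_star)
  then show ?thesis
    by (simp only: bidual_star_star)
qed

lemma bidual_star_in_range_iff: "bidual_star T \<in> range to_bidual \<longleftrightarrow> T \<in> range to_bidual"
proof -
  have "bidual_star S \<in> range to_bidual" if "S \<in> range to_bidual" for S :: "'a bidual"
    using that by (auto simp flip: to_bidual_star)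
  from this[of T] this[of "bidual_star T"] show ?thesis
    by (auto simp: bidual_star_star)
qed

lemma bidual_star_LM_iff: "bidual_star T \<in> LM \<longleftrightarrow> T \<in> RM"
proof -
  have "bidual_star T \<odot> to_bidual (star a) \<in> range to_bidual
      \<longleftrightarrow> to_bidual a \<odot> T \<in> range to_bidual" for a
    unfolding bidual_star_to_bidual_arens[symmetric] by (rule bidual_star_in_range_iff)
  moreover have "(\<forall>a. P a) \<longleftrightarrow> (\<forall>a. P (star a))" for P :: "'a \<Rightarrow> bool"
    using star_star by metis
  note this[of "\<lambda>a. bidual_star T \<odot> to_bidual a \<in> range to_bidual"]
  ultimately show ?thesis
    unfolding LM_def RM_def by simp
qed

lemma bidual_star_RM_iff: "bidual_star T \<in> RM \<longleftrightarrow> T \<in> LM"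
  using bidual_star_LM_iff[of "bidual_star T"] by (simp add: bidual_star_star)

lemma bidual_star_QM:
  assumes "T \<in> QM"
  shows "bidual_star T \<in> QM"
proof -
  have "to_bidual a \<odot> bidual_star T \<odot> to_bidual b \<in> range to_bidual" for a b
  proof -
    have "bidual_star (to_bidual a \<odot> bidual_star T \<odot> to_bidual b)
        = to_bidual (star b) \<odot> T \<odot> to_bidual (star a)"
      by (simp add: bidual_star_arens_to_bidual bidual_star_to_bidual_arens bidual_star_star arens_assoc)
    also have "\<dots> \<in> range to_bidual"
      using assms by (simp add: QM_def)
    finally show ?thesis
      by (simp only: bidual_star_in_range_iff)
  qed
  then show ?thesis
    by (simp add: QM_def)
qed

lemma range_to_bidual_arens:
  assumes "S \<in> range to_bidual" "T \<in> range to_bidual"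
  shows "S \<odot> T \<in> range to_bidual"
proof -
  obtain a b where "S = to_bidual a" "T = to_bidual b"
    using assms by blast
  then have "S \<odot> T = to_bidual (a * b)"
    by (simp only: to_bidual_mult)
  then show ?thesis
    by (rule range_eqI)
qed

lemma range_to_bidual_add:
  assumes "S \<in> range to_bidual" "T \<in> range to_bidual"
  shows "S + T \<in> range to_bidual"
proof -
  obtain a b where "S = to_bidual a" "T = to_bidual b"
    using assms by blast
  then have "S + T = to_bidual (a + b)"
    by (simp only: to_bidual_add)
  then show ?thesis
    by (rule range_eqI)
qed

lemma range_to_bidual_scaleC:
  assumes "T \<in> range to_bidual"
  shows "c *\<^sub>C T \<in> range to_bidual"
proof -
  obtain a where "T = to_bidual a"
    using assms by blast
  then have "c *\<^sub>C T = to_bidual (c *\<^sub>C a)"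
    by (simp only: to_bidual_scaleC)
  then show ?thesis
    by (rule range_eqI)
qed

text \<open>
  These sets are the tool for all density arguments below: whether \<open>R a\<close> belongs to the algebra may be
  tested on a subset with \<open>a\<close> in its closure.
\<close>

lemma closed_arens_in_range:
  "closed {a. R \<odot> to_bidual a \<in> range to_bidual}" "closed {a. to_bidual a \<odot> R \<in> range to_bidual}"
  using closed_vimage[OF closed_range_to_bidual, of "\<lambda>a. R \<odot> to_bidual a"]
    closed_vimage[OF closed_range_to_bidual, of "\<lambda>a. to_bidual a \<odot> R"]
    linear_continuous_on[OF bounded_linear_arens_right, of UNIV R]
    linear_continuous_on[OF bounded_linear_arens_left, of UNIV R]
  by (simp_all add: vimage_def)

lemma arens_in_range_by_factorization:
  assumes "\<And>z. R \<odot> to_bidual (a * star a * z) \<in> range to_bidual"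
  shows "R \<odot> to_bidual a \<in> range to_bidual"
  using closed_contains_by_factorization[OF closed_arens_in_range(1)[of R], of a] assms by simp

lemma arens_in_range_by_factorization_left:
  assumes "\<And>z. to_bidual (z * star a * a) \<odot> R \<in> range to_bidual"
  shows "to_bidual a \<odot> R \<in> range to_bidual"
  using closed_contains_by_factorization_left[OF closed_arens_in_range(2)[of R], of a] assms by simp

section \<open>Multipliers and quasi-multipliers\<close>

lemma LM_arens:
  assumes "S \<in> LM" "T \<in> LM"
  shows "S \<odot> T \<in> LM"
  unfolding LM_def
proof (intro CollectI allI)
  fix a
  obtain b where "T \<odot> to_bidual a = to_bidual b"
    using assms(2) unfolding LM_def by blast
  then have "S \<odot> T \<odot> to_bidual a = S \<odot> to_bidual b"
    by (simp only: arens_assoc)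
  then show "S \<odot> T \<odot> to_bidual a \<in> range to_bidual"
    using assms(1) by (simp add: LM_def)
qed

lemma RM_arens:
  assumes "S \<in> RM" "T \<in> RM"
  shows "S \<odot> T \<in> RM"
  unfolding RM_def
proof (intro CollectI allI)
  fix a
  obtain b where "to_bidual a \<odot> S = to_bidual b"
    using assms(1) unfolding RM_def by blast
  then have "to_bidual a \<odot> (S \<odot> T) = to_bidual b \<odot> T"
    by (simp flip: arens_assoc)
  then show "to_bidual a \<odot> (S \<odot> T) \<in> range to_bidual"
    using assms(2) by (simp add: RM_def)
qed

lemma QM_arens_left:
  assumes "m \<in> RM" "T \<in> QM"
  shows "m \<odot> T \<in> QM"
  unfolding QM_def
proof (intro CollectI allI)
  fix a b
  obtain c where "to_bidual a \<odot> m = to_bidual c"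
    using assms(1) unfolding RM_def by blast
  then have "to_bidual a \<odot> (m \<odot> T) \<odot> to_bidual b = to_bidual c \<odot> T \<odot> to_bidual b"
    by (simp flip: arens_assoc)
  then show "to_bidual a \<odot> (m \<odot> T) \<odot> to_bidual b \<in> range to_bidual"
    using assms(2) by (simp add: QM_def)
qed

lemma QM_arens_right:
  assumes "m \<in> LM" "T \<in> QM"
  shows "T \<odot> m \<in> QM"
  unfolding QM_def
proof (intro CollectI allI)
  fix a b
  obtain c where "m \<odot> to_bidual b = to_bidual c"
    using assms(1) unfolding LM_def by blast
  then have "to_bidual a \<odot> (T \<odot> m) \<odot> to_bidual b = to_bidual a \<odot> T \<odot> to_bidual c"
    by (simp add: arens_assoc)
  then show "to_bidual a \<odot> (T \<odot> m) \<odot> to_bidual b \<in> range to_bidual"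
    using assms(2) by (simp add: QM_def)
qed

lemma LM_subset_QM: "LM \<subseteq> QM"
proof
  fix T :: "'a bidual" assume "T \<in> LM"
  then have "T \<odot> to_bidual b \<in> range to_bidual" for b
    by (simp add: LM_def)
  then show "T \<in> QM"
    by (simp add: QM_def arens_assoc range_to_bidual_arens)
qed

lemma RM_subset_QM: "RM \<subseteq> QM"
proof
  fix T :: "'a bidual" assume "T \<in> RM"
  then have "to_bidual a \<odot> T \<in> range to_bidual" for a
    by (simp add: RM_def)
  then show "T \<in> QM"
    by (simp add: QM_def range_to_bidual_arens)
qed

lemma QM_to_bidual_in_RM: "T \<in> QM \<Longrightarrow> T \<odot> to_bidual b \<in> RM"
  by (simp add: QM_def RM_def arens_assoc)

text \<open>
  The adjoint preserves \<open>QM\<close> and exchanges \<open>LM\<close> with \<open>RM\<close>.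
\<close>

lemma QM_eq_M_iff: "(QM :: 'a :: cstar_algebra bidual set) = M \<longleftrightarrow> (QM :: 'a bidual set) \<subseteq> LM"
proof
  assume *: "QM \<subseteq> (LM :: 'a bidual set)"
  have "T \<in> RM" if "T \<in> QM" for T :: "'a bidual"
    using bidual_star_QM[OF that] * bidual_star_LM_iff by blast
  with * show "(QM :: 'a bidual set) = M"
    using LM_subset_QM by (auto simp: M_def)
qed (auto simp: M_def)

text \<open>
  If \<open>LM = M\<close>, then \<open>RM \<subseteq> LM\<close> by adjoints. For a quasi-multiplier \<open>T\<close>, the right multiplier \<open>T b\<close> is
  then a left multiplier, so \<open>T b c \<in> A\<close> for all \<open>b\<close> and \<open>c\<close>, and factorization removes \<open>c\<close>.
\<close>

theorem LM_eq_M_iff_QM_eq_M: "(LM :: 'a :: cstar_algebra bidual set) = M \<longleftrightarrow> (QM :: 'a bidual set) = M"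
proof
  assume QM: "(QM :: 'a bidual set) = M"
  show "(LM :: 'a bidual set) = M"
    using LM_subset_QM QM by (auto simp: M_def)
next
  assume LM: "(LM :: 'a bidual set) = M"
  have RM: "T \<in> LM" if "T \<in> RM" for T :: "'a bidual"
  proof -
    have "bidual_star T \<in> LM"
      using that by (simp only: bidual_star_LM_iff)
    then have "bidual_star T \<in> RM"
      unfolding LM unfolding M_def by blast
    then show ?thesis
      by (simp only: bidual_star_RM_iff)
  qed
  have "QM \<subseteq> (LM :: 'a bidual set)"
  proof
    fix T :: "'a bidual" assume "T \<in> QM"
    then have *: "T \<odot> to_bidual b \<odot> to_bidual c \<in> range to_bidual" for b c
      using RM[OF QM_to_bidual_in_RM] by (simp add: LM_def)
    have "T \<odot> to_bidual b \<in> range to_bidual" for b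
    proof (rule arens_in_range_by_factorization)
      show "T \<odot> to_bidual (b * star b * z) \<in> range to_bidual" for z
        using *[of b "star b * z"] by (simp add: to_bidual_mult arens_assoc)
    qed
    then show "T \<in> LM"
      by (simp add: LM_def)
  qed
  then show "(QM :: 'a bidual set) = M"
    by (simp only: QM_eq_M_iff)
qed

section \<open>Complementary multiplier projections\<close>

text \<open>
  The part of a Hilbert C*-bimodule that lives in the linking algebra. It is symmetric in \<open>p\<close> and
  \<open>q\<close>, so every result can also be read with the two exchanged.
\<close>

locale complementary_projections =
  fixes p q :: "'l :: cstar_algebra bidual"
  assumes p_mult: "p \<in> M" and p_proj: "is_projection p"
    and q_mult: "q \<in> M" and q_proj: "is_projection q"
    and p_plus_q: "is_bidual_unit (p + q)"
begin

lemma swap: "complementary_projections q p"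
  using p_mult p_proj q_mult q_proj p_plus_q by (simp add: complementary_projections_def add.commute)

lemma projections_simps: "p \<odot> p = p" "q \<odot> q = q" "p \<odot> (p \<odot> T) = p \<odot> T" "q \<odot> (q \<odot> T) = q \<odot> T"
    "bidual_star p = p" "bidual_star q = q"
  using p_proj q_proj by (simp_all add: is_projection_def flip: arens_assoc)

lemma decompose: "p \<odot> T + q \<odot> T = T"
  using p_plus_q by (simp add: is_bidual_unit_def flip: arens_add_left)

text \<open>
  The values of \<open>a S\<close> for all \<open>a\<close> determine the operator \<open>f \<mapsto> S f\<close> on the dual. This operator
  determines \<open>(p + q) S = S\<close>.
\<close>

lemma eqI_left:
  fixes S T :: "'l bidual"
  assumes "\<And>a. to_bidual a \<odot> S = to_bidual a \<odot> T"
  shows "S = T"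
proof -
  have "bidual_lact S f = bidual_lact T f" for f
  proof (rule cdual_eqI)
    fix a
    have "cdual_apply (to_bidual a \<odot> S) f = cdual_apply (to_bidual a \<odot> T) f"
      by (simp only: assms)
    then show "cdual_apply (bidual_lact S f) a = cdual_apply (bidual_lact T f) a"
      by (simp only: to_bidual_arens_apply bidual_lact_apply)
  qed
  then have "(p + q) \<odot> S = (p + q) \<odot> T"
    by (intro cdual_eqI) (simp add: arens_apply)
  then show ?thesis
    using p_plus_q by (simp add: is_bidual_unit_def)
qed

lemma eqI_right:
  fixes S T :: "'l bidual"
  assumes "\<And>a. S \<odot> to_bidual a = T \<odot> to_bidual a"
  shows "S = T"
proof -
  have "to_bidual a \<odot> bidual_star S = to_bidual a \<odot> bidual_star T" for a
    using arg_cong[OF assms[of "star a"], of bidual_star]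
    by (simp add: bidual_star_arens_to_bidual star_star)
  then have "bidual_star S = bidual_star T"
    by (rule eqI_left)
  then have "bidual_star (bidual_star S) = bidual_star (bidual_star T)"
    by (rule arg_cong)
  then show ?thesis
    by (simp only: bidual_star_star)
qed

text \<open>
  Test both sides on \<open>a \<in> L\<close>: the product \<open>a\<^sup>* m\<close> lies in \<open>L\<close>, and there the adjoint reverses
  products.
\<close>

lemma bidual_star_arens_left:
  fixes m T :: "'l bidual"
  assumes "m \<in> RM"
  shows "bidual_star (m \<odot> T) = bidual_star T \<odot> bidual_star m"
proof (rule eqI_right)
  fix a
  obtain d where d: "to_bidual (star a) \<odot> m = to_bidual d"
    using assms unfolding RM_def by blast
  have "bidual_star m \<odot> to_bidual a = bidual_star (to_bidual (star a) \<odot> m)"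
    by (simp add: bidual_star_to_bidual_arens star_star)
  also have "\<dots> = to_bidual (star d)"
    by (subst d) (rule to_bidual_star[symmetric])
  finally have m: "bidual_star m \<odot> to_bidual a = to_bidual (star d)" .
  have "bidual_star (m \<odot> T) \<odot> to_bidual a = bidual_star (to_bidual (star a) \<odot> (m \<odot> T))"
    by (simp add: bidual_star_to_bidual_arens star_star)
  also have "\<dots> = bidual_star (to_bidual d \<odot> T)"
    by (simp only: d flip: arens_assoc)
  also have "\<dots> = bidual_star T \<odot> bidual_star m \<odot> to_bidual a"
    by (simp add: bidual_star_to_bidual_arens arens_assoc m)
  finally show "bidual_star (m \<odot> T) \<odot> to_bidual a = bidual_star T \<odot> bidual_star m \<odot> to_bidual a" .
qed

lemma bidual_star_arens_right:
  fixes m T :: "'l bidual"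
  assumes "m \<in> LM"
  shows "bidual_star (T \<odot> m) = bidual_star m \<odot> bidual_star T"
proof -
  have "T \<odot> m = bidual_star (bidual_star m \<odot> bidual_star T)"
    using assms by (simp add: bidual_star_arens_left bidual_star_RM_iff bidual_star_star)
  then show ?thesis
    by (simp only: bidual_star_star)
qed

lemma p_q_LM_RM: "p \<in> LM" "p \<in> RM" "q \<in> LM" "q \<in> RM"
  using p_mult q_mult by (auto simp: M_def)

lemma bidual_star_corner: "bidual_star (p \<odot> T \<odot> q) = q \<odot> bidual_star T \<odot> p"
  using p_q_LM_RM
  by (simp add: bidual_star_arens_left bidual_star_arens_right projections_simps arens_assoc)

lemma compression_image_iff:
  assumes "\<And>T. T \<in> S \<Longrightarrow> p \<odot> T \<odot> q \<in> S"
  shows "T \<in> (\<lambda>T. p \<odot> T \<odot> q) ` S \<longleftrightarrow> T \<in> S \<and> p \<odot> T \<odot> q = T"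
proof
  assume "T \<in> (\<lambda>T. p \<odot> T \<odot> q) ` S"
  then obtain R where "R \<in> S" "T = p \<odot> R \<odot> q"
    by blast
  then show "T \<in> S \<and> p \<odot> T \<odot> q = T"
    using assms by (simp add: arens_assoc projections_simps)
next
  assume "T \<in> S \<and> p \<odot> T \<odot> q = T"
  then show "T \<in> (\<lambda>T. p \<odot> T \<odot> q) ` S"
    by (intro rev_image_eqI[of T]) auto
qed

lemma compression_LM: "T \<in> LM \<Longrightarrow> p \<odot> T \<odot> q \<in> LM"
  by (intro LM_arens p_q_LM_RM)

lemma compression_RM: "T \<in> RM \<Longrightarrow> p \<odot> T \<odot> q \<in> RM"
  by (intro RM_arens p_q_LM_RM)

lemma compression_QM: "T \<in> QM \<Longrightarrow> p \<odot> T \<odot> q \<in> QM"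
  by (rule QM_arens_right[OF p_q_LM_RM(3) QM_arens_left[OF p_q_LM_RM(2)]])

lemma LMX_iff: "T \<in> LMX p q \<longleftrightarrow> T \<in> LM \<and> p \<odot> T \<odot> q = T"
  unfolding LMX_def by (intro compression_image_iff compression_LM)

lemma RMX_iff: "T \<in> RMX p q \<longleftrightarrow> T \<in> RM \<and> p \<odot> T \<odot> q = T"
  unfolding RMX_def by (intro compression_image_iff compression_RM)

lemma QMX_iff: "T \<in> QMX p q \<longleftrightarrow> T \<in> QM \<and> p \<odot> T \<odot> q = T"
  unfolding QMX_def by (intro compression_image_iff compression_QM)

lemma QMX_eq_LMX_iff: "QMX p q = LMX p q \<longleftrightarrow> (\<forall>T\<in>QM. p \<odot> T \<odot> q \<in> LM)"
proof
  assume "QMX p q = LMX p q"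
  moreover have "p \<odot> T \<odot> q \<in> QMX p q" if "T \<in> QM" for T
    using that by (auto simp: QMX_def)
  ultimately show "\<forall>T\<in>QM. p \<odot> T \<odot> q \<in> LM"
    by (auto simp: LMX_iff)
next
  assume *: "\<forall>T\<in>QM. p \<odot> T \<odot> q \<in> LM"
  have "T \<in> LM" if "T \<in> QM" "p \<odot> T \<odot> q = T" for T
    using *[rule_format, OF that(1)] that(2) by simp
  then show "QMX p q = LMX p q"
    using LM_subset_QM by (auto simp: QMX_iff LMX_iff)
qed

text \<open>
  Let \<open>T\<close> be a quasi-multiplier. For \<open>b \<in> L\<close>, the element \<open>p T q b q\<close> lies in \<open>RM(X)\<close>. If
  \<open>RM(X) \<subseteq> LM(X)\<close>, then \<open>p T q b q c \<in> L\<close> for all \<open>b\<close> and \<open>c\<close>. With \<open>k = q l\<close>, the elements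
  \<open>k k\<^sup>* z = q (k l\<^sup>*) q z\<close> are of the form required for \<open>b\<close> and \<open>c\<close>, and factorization reaches \<open>k\<close>.
\<close>

theorem QMX_eq_LMX_iff_RMX_subset_LMX: "QMX p q = LMX p q \<longleftrightarrow> RMX p q \<subseteq> LMX p q"
proof
  assume "QMX p q = LMX p q"
  then show "RMX p q \<subseteq> LMX p q"
    using RM_subset_QM by (auto simp: QMX_def RMX_def)
next
  assume sub: "RMX p q \<subseteq> LMX p q"
  have "p \<odot> T \<odot> q \<in> LM" if "T \<in> QM" for T
  proof -
    have *: "p \<odot> T \<odot> q \<odot> to_bidual b \<odot> q \<odot> to_bidual c \<in> range to_bidual" for b c
    proof -
      have "T \<odot> q \<odot> to_bidual b \<in> RM"
        using that p_q_LM_RM by (intro QM_to_bidual_in_RM QM_arens_right)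
      then have "p \<odot> (T \<odot> q \<odot> to_bidual b) \<odot> q \<in> RMX p q"
        unfolding RMX_def by (rule imageI)
      then have "p \<odot> (T \<odot> q \<odot> to_bidual b) \<odot> q \<in> LM"
        using sub by (auto simp: LMX_iff)
      then show ?thesis
        by (simp add: LM_def arens_assoc)
    qed
    have "p \<odot> T \<odot> q \<odot> to_bidual l \<in> range to_bidual" for l
    proof -
      obtain k where k: "q \<odot> to_bidual l = to_bidual k"
        using p_q_LM_RM by (auto simp: LM_def)
      have star_k: "to_bidual (star k) = to_bidual (star l) \<odot> q"
        unfolding to_bidual_star[of k] k[symmetric]
        by (simp add: bidual_star_arens_to_bidual projections_simps)
      have "p \<odot> T \<odot> q \<odot> to_bidual (k * star k * z) \<in> range to_bidual" for z
        using *[of "k * star l" z] by (simp add: to_bidual_mult star_k arens_assoc)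
      then have "p \<odot> T \<odot> q \<odot> to_bidual k \<in> range to_bidual"
        by (rule arens_in_range_by_factorization)
      then show ?thesis
        by (simp add: projections_simps arens_assoc flip: k)
    qed
    then show ?thesis
      by (simp add: LM_def)
  qed
  then show "QMX p q = LMX p q"
    by (simp add: QMX_eq_LMX_iff)
qed

lemma all_bidual_star: "(\<forall>T. P T) \<longleftrightarrow> (\<forall>T. P (bidual_star T))"
proof
  assume *: "\<forall>T. P (bidual_star T)"
  show "\<forall>T. P T"
  proof
    show "P T" for T
      using spec[OF *, of "bidual_star T"] by (simp only: bidual_star_star)
  qed
qed blast

lemma bidual_star_QMX_iff: "bidual_star T \<in> QMX q p \<longleftrightarrow> T \<in> QMX p q"
proof -
  interpret swapped: complementary_projections q p
    by (rule swap)
  have "q \<odot> bidual_star T \<odot> p = bidual_star T \<longleftrightarrow> p \<odot> T \<odot> q = T"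
    using bidual_star_corner[of T] swapped.bidual_star_corner[of "bidual_star T"]
    by (auto simp: bidual_star_star)
  moreover have "bidual_star T \<in> QM \<longleftrightarrow> T \<in> QM"
    using bidual_star_QM[of T] bidual_star_QM[of "bidual_star T"] by (auto simp: bidual_star_star)
  ultimately show ?thesis
    by (simp add: QMX_iff swapped.QMX_iff)
qed

lemma bidual_star_LMX_iff: "bidual_star T \<in> LMX q p \<longleftrightarrow> T \<in> RMX p q"
proof -
  interpret swapped: complementary_projections q p
    by (rule swap)
  have "q \<odot> bidual_star T \<odot> p = bidual_star T \<longleftrightarrow> p \<odot> T \<odot> q = T"
    using bidual_star_corner[of T] swapped.bidual_star_corner[of "bidual_star T"]
    by (auto simp: bidual_star_star)
  then show ?thesis
    by (simp add: RMX_iff swapped.LMX_iff bidual_star_LM_iff)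
qed

text \<open>
  The adjoint maps \<open>X\<^sup>*\<^sup>* = p L\<^sup>*\<^sup>* q\<close> onto \<open>q L\<^sup>*\<^sup>* p\<close>.
\<close>

lemma QMX_eq_RMX_iff_swap: "QMX p q = RMX p q \<longleftrightarrow> QMX q p = LMX q p"
proof -
  have "T \<in> QMX q p \<longleftrightarrow> bidual_star T \<in> QMX p q" "T \<in> LMX q p \<longleftrightarrow> bidual_star T \<in> RMX p q" for T
    using bidual_star_QMX_iff[of "bidual_star T"] bidual_star_LMX_iff[of "bidual_star T"]
    by (simp_all add: bidual_star_star)
  then show ?thesis
    unfolding set_eq_iff using all_bidual_star[of "\<lambda>T. T \<in> QMX p q \<longleftrightarrow> T \<in> RMX p q"] by simp
qed

theorem QMX_eq_RMX_iff_LMX_subset_RMX: "QMX p q = RMX p q \<longleftrightarrow> LMX p q \<subseteq> RMX p q"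
proof -
  interpret swapped: complementary_projections q p
    by (rule swap)
  have "RMX q p \<subseteq> LMX q p \<longleftrightarrow> LMX p q \<subseteq> RMX p q"
  proof -
    have "bidual_star T \<in> RMX q p \<longleftrightarrow> T \<in> LMX p q" for T
      using swapped.bidual_star_LMX_iff[of "bidual_star T"] by (simp add: bidual_star_star)
    then show ?thesis
      unfolding subset_iff
      by (subst all_bidual_star) (simp add: bidual_star_LMX_iff)
  qed
  then show ?thesis
    by (simp add: QMX_eq_RMX_iff_swap swapped.QMX_eq_LMX_iff_RMX_subset_LMX)
qed

end

section \<open>Full corners\<close>

text \<open>
  The elements \<open>k\<close> with \<open>e T m k \<in> L\<close> for all \<open>m\<close> form a closed ideal; the quantifier over \<open>m\<close> is what
  makes it a left ideal. It contains \<open>r L r\<close>, since \<open>T m\<close> is again a quasi-multiplier and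
  \<open>e (T m) r\<close> is a left multiplier.
\<close>

lemma full_corner_LM:
  assumes r: "r \<in> RM" and full: "closed_ideal_generated (corner r r) = UNIV"
    and LM: "\<And>T. T \<in> QM \<Longrightarrow> e \<odot> T \<odot> r \<in> LM"
    and T: "T \<in> QM"
  shows "e \<odot> T \<in> LM"
proof -
  let ?I = "{k. \<forall>m. e \<odot> T \<odot> to_bidual (m * k) \<in> range to_bidual}"
  have "is_closed_ideal ?I"
    unfolding is_closed_ideal_def
  proof (intro conjI ballI allI)
    have "?I = (\<Inter>m. {k. e \<odot> T \<odot> to_bidual m \<odot> to_bidual k \<in> range to_bidual})"
      by (auto simp: to_bidual_mult arens_assoc)
    also have "closed \<dots>"
      by (intro closed_INT ballI closed_arens_in_range)
    finally show "closed ?I" .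
    have "to_bidual 0 = 0"
      by (rule linear_0[OF bounded_linear.linear[OF bounded_linear_to_bidual]])
    then have "e \<odot> T \<odot> to_bidual 0 = to_bidual 0"
      using linear_0[OF bounded_linear.linear[OF bounded_linear_arens_right[of "e \<odot> T"]]] by simp
    then show "0 \<in> ?I"
      by simp
    show "x + y \<in> ?I" if "x \<in> ?I" "y \<in> ?I" for x y
      using that by (simp only: mem_Collect_eq distrib_left to_bidual_add arens_add_right)
        (blast intro: range_to_bidual_add)
    show "c *\<^sub>C x \<in> ?I" if "x \<in> ?I" for c x
      using that by (simp only: mem_Collect_eq mult_scaleC_right to_bidual_scaleC arens_scaleC_right)
        (blast intro: range_to_bidual_scaleC)
    show "l * x \<in> ?I" if "x \<in> ?I" for l x
      using that by (simp flip: mult.assoc)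
    show "x * l \<in> ?I" if "x \<in> ?I" for l x
    proof -
      have "e \<odot> T \<odot> to_bidual (m * x) \<odot> to_bidual l \<in> range to_bidual" for m
        using that by (intro range_to_bidual_arens[of "e \<odot> T \<odot> to_bidual (m * x)"]) auto
      then show ?thesis
        by (simp add: to_bidual_mult arens_assoc)
    qed
  qed
  moreover have "corner r r \<subseteq> ?I"
  proof
    fix k assume "k \<in> corner r r"
    then obtain l where l: "to_bidual k = r \<odot> to_bidual l \<odot> r"
      by (auto simp: corner_def)
    obtain l' where l': "to_bidual l \<odot> r = to_bidual l'"
      using r by (auto simp: RM_def)
    have "e \<odot> T \<odot> to_bidual (m * k) \<in> range to_bidual" for m
    proof -
      have "e \<odot> (T \<odot> to_bidual m) \<odot> r \<in> LM"
        using T QM_to_bidual_in_RM RM_subset_QM by (intro LM) blast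
      then have "e \<odot> (T \<odot> to_bidual m) \<odot> r \<odot> to_bidual l' \<in> range to_bidual"
        by (simp add: LM_def)
      then show ?thesis
        by (simp add: to_bidual_mult l arens_assoc l')
    qed
    then show "k \<in> ?I"
      by simp
  qed
  ultimately have "closed_ideal_generated (corner r r) \<subseteq> ?I"
    unfolding closed_ideal_generated_def by blast
  then have "e \<odot> T \<odot> to_bidual (m * k) \<in> range to_bidual" for m k
    using full by auto
  then have "e \<odot> T \<odot> to_bidual a \<in> range to_bidual" for a
    by (rule arens_in_range_by_factorization)
  then show ?thesis
    by (simp add: LM_def)
qed

lemma full_corner_LM_iff:
  assumes "r \<in> M" and "closed_ideal_generated (corner r r) = UNIV"
  shows "(\<forall>T\<in>QM. e \<odot> T \<odot> r \<in> LM) \<longleftrightarrow> (\<forall>T\<in>QM. e \<odot> T \<in> LM)"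
  using full_corner_LM[of r e] assms by (auto simp: M_def intro: LM_arens)

section \<open>Corners and their enveloping algebras\<close>

definition bounded_clinear :: "('a :: complex_normed_vector \<Rightarrow> 'b :: complex_normed_vector) \<Rightarrow> bool"
  where "bounded_clinear \<phi> \<longleftrightarrow> bounded_linear \<phi> \<and> (\<forall>c x. \<phi> (c *\<^sub>C x) = c *\<^sub>C \<phi> x)"

lemma bounded_clinearI:
  assumes "\<And>x y. \<phi> (x + y) = \<phi> x + \<phi> y" "\<And>c x. \<phi> (c *\<^sub>C x) = c *\<^sub>C \<phi> x"
    "\<And>x. norm (\<phi> x) \<le> norm x * K"
  shows "bounded_clinear \<phi>"
  unfolding bounded_clinear_def
proof (intro conjI allI bounded_linear_intro[of \<phi> K])
  show "\<phi> (r *\<^sub>R x) = r *\<^sub>R \<phi> x" for r x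
    using assms(2)[of "complex_of_real r" x] by (simp add: scaleC_of_real)
qed (use assms in auto)

text \<open>
  Meaningful only for \<open>bounded_clinear \<phi>\<close>; otherwise \<open>Cdual\<close> is applied outside its domain.
\<close>

definition pullback :: "('a :: complex_normed_vector \<Rightarrow> 'b :: complex_normed_vector) \<Rightarrow> 'b cdual \<Rightarrow> 'a cdual"
  where "pullback \<phi> f = Cdual (\<lambda>x. cdual_apply f (\<phi> x))"

lemma pullback_apply:
  assumes "bounded_clinear \<phi>"
  shows "cdual_apply (pullback \<phi> f) x = cdual_apply f (\<phi> x)"
proof -
  have "bounded_linear (\<lambda>x. cdual_apply f (\<phi> x)) \<and> (\<forall>c x. cdual_apply f (\<phi> (c *\<^sub>C x)) = c * cdual_apply f (\<phi> x))"
    using assms bounded_linear_compose[OF bounded_linear_cdual_apply]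
    by (auto simp: bounded_clinear_def cdual_apply_scaleC_arg)
  then show ?thesis
    by (simp add: pullback_def Cdual_inverse)
qed

lemma bounded_clinear_pullback:
  assumes "bounded_clinear \<phi>"
  shows "bounded_clinear (pullback \<phi>)"
proof -
  obtain K where K: "K \<ge> 0" "\<And>x. norm (\<phi> x) \<le> norm x * K"
    using assms bounded_linear.nonneg_bounded unfolding bounded_clinear_def by blast
  show ?thesis
  proof (rule bounded_clinearI)
    show "norm (pullback \<phi> f) \<le> norm f * K" for f
    proof (rule norm_cdual_le)
      fix x
      have "cmod (cdual_apply (pullback \<phi> f) x) \<le> norm f * norm (\<phi> x)"
        by (simp add: pullback_apply[OF assms] norm_cdual_apply_le)
      also have "\<dots> \<le> norm f * (norm x * K)"
        by (intro mult_left_mono K) simp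
      finally show "cmod (cdual_apply (pullback \<phi> f) x) \<le> norm f * K * norm x"
        by (simp add: mult_ac)
    qed (use K in simp)
  qed (auto intro!: cdual_eqI simp: pullback_apply[OF assms] plus_cdual.rep_eq scaleC_cdual.rep_eq)
qed

definition bitranspose :: "('a :: complex_normed_vector \<Rightarrow> 'b :: complex_normed_vector) \<Rightarrow> 'a bidual \<Rightarrow> 'b bidual"
  where "bitranspose \<phi> = pullback (pullback \<phi>)"

lemma bitranspose_apply:
  "bounded_clinear \<phi> \<Longrightarrow> cdual_apply (bitranspose \<phi> T) f = cdual_apply T (pullback \<phi> f)"
  unfolding bitranspose_def by (rule pullback_apply[OF bounded_clinear_pullback])

lemma bitranspose_to_bidual:
  "bounded_clinear \<phi> \<Longrightarrow> bitranspose \<phi> (to_bidual a) = to_bidual (\<phi> a)"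
  by (rule cdual_eqI) (simp add: bitranspose_apply to_bidual.rep_eq pullback_apply)

lemma bitranspose_bitranspose:
  assumes "bounded_clinear \<phi>" "bounded_clinear \<psi>" "bounded_clinear \<theta>" "\<And>x. \<phi> (\<psi> x) = \<theta> x"
  shows "bitranspose \<phi> (bitranspose \<psi> T) = bitranspose \<theta> T"
proof -
  have "pullback \<psi> (pullback \<phi> f) = pullback \<theta> f" for f
    by (rule cdual_eqI) (simp add: pullback_apply assms)
  then show ?thesis
    by (intro cdual_eqI) (simp add: bitranspose_apply assms)
qed

lemma bitranspose_id:
  assumes "bounded_clinear \<phi>" "\<And>x. \<phi> x = x"
  shows "bitranspose \<phi> T = T"
proof -
  have "pullback \<phi> f = f" for f
    by (rule cdual_eqI) (simp add: pullback_apply assms)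
  then show ?thesis
    by (intro cdual_eqI) (simp add: bitranspose_apply assms)
qed

lemma
  assumes \<phi>: "bounded_clinear \<phi>" and mult: "\<And>a b. \<phi> (a * b) = \<phi> a * \<phi> b"
  shows bitranspose_to_bidual_arens: "bitranspose \<phi> (to_bidual a \<odot> T) = to_bidual (\<phi> a) \<odot> bitranspose \<phi> T"
    and bitranspose_arens_to_bidual: "bitranspose \<phi> (T \<odot> to_bidual b) = bitranspose \<phi> T \<odot> to_bidual (\<phi> b)"
proof -
  have "cdual_ract (pullback \<phi> f) a = pullback \<phi> (cdual_ract f (\<phi> a))" for f
    by (rule cdual_eqI) (simp add: cdual_ract.rep_eq pullback_apply[OF \<phi>] mult)
  then show "bitranspose \<phi> (to_bidual a \<odot> T) = to_bidual (\<phi> a) \<odot> bitranspose \<phi> T"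
    by (intro cdual_eqI) (simp add: bitranspose_apply[OF \<phi>] to_bidual_arens_apply)
  have "bidual_lact (to_bidual b) (pullback \<phi> f) = pullback \<phi> (bidual_lact (to_bidual (\<phi> b)) f)" for f
    by (rule cdual_eqI) (simp add: bidual_lact_to_bidual_apply pullback_apply[OF \<phi>] mult)
  then show "bitranspose \<phi> (T \<odot> to_bidual b) = bitranspose \<phi> T \<odot> to_bidual (\<phi> b)"
    by (intro cdual_eqI) (simp add: bitranspose_apply[OF \<phi>] arens_apply)
qed

context complementary_projections
begin

text \<open>
  Multiplying by \<open>a \<in> L\<close> from the left replaces \<open>p\<close> by \<open>d = a p \<in> L\<close>, and then the right factor \<open>p\<close> acts
  on functionals of the form \<open>b \<mapsto> f (d b)\<close>, where both sides can be evaluated.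
\<close>

lemma bitranspose_compression:
  assumes \<phi>: "bounded_clinear \<phi>" and comp: "\<And>l. to_bidual (\<phi> l) = p \<odot> to_bidual l \<odot> p"
  shows "bitranspose \<phi> T = p \<odot> T \<odot> p"
proof (rule eqI_left)
  fix a
  obtain d where d: "to_bidual a \<odot> p = to_bidual d"
    using p_q_LM_RM by (auto simp: RM_def)
  have "pullback \<phi> (cdual_ract f a) = cdual_ract (bidual_lact p f) d" for f
  proof (rule cdual_eqI)
    fix b
    have "cdual_apply (pullback \<phi> (cdual_ract f a)) b = cdual_apply (to_bidual a \<odot> to_bidual (\<phi> b)) f"
      by (simp add: pullback_apply[OF \<phi>] cdual_ract.rep_eq to_bidual.rep_eq flip: to_bidual_mult)
    also have "to_bidual a \<odot> to_bidual (\<phi> b) = to_bidual (d * b) \<odot> p"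
      by (simp add: comp to_bidual_mult flip: arens_assoc d)
    also have "cdual_apply \<dots> f = cdual_apply (cdual_ract (bidual_lact p f) d) b"
      by (simp add: arens_apply to_bidual.rep_eq cdual_ract.rep_eq)
    finally show "cdual_apply (pullback \<phi> (cdual_ract f a)) b = cdual_apply (cdual_ract (bidual_lact p f) d) b" .
  qed
  moreover have "to_bidual a \<odot> (p \<odot> T \<odot> p) = to_bidual d \<odot> T \<odot> p"
    by (simp flip: arens_assoc d)
  ultimately show "to_bidual a \<odot> bitranspose \<phi> T = to_bidual a \<odot> (p \<odot> T \<odot> p)"
    by (intro cdual_eqI) (simp add: to_bidual_arens_apply bitranspose_apply[OF \<phi>] arens_apply[of _ p])
qed

lemma ex_compression: "\<exists>x. to_bidual x = p \<odot> to_bidual l \<odot> p"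
proof -
  obtain k where k: "p \<odot> to_bidual l = to_bidual k"
    using p_q_LM_RM by (auto simp: LM_def)
  have "to_bidual k \<odot> p \<in> range to_bidual"
    using p_q_LM_RM by (auto simp: RM_def)
  then show ?thesis
    unfolding k by auto
qed

text \<open>
  Since \<open>R l = R (p l)\<close>, it is enough to reach \<open>k = p l\<close>. By factorization this follows from
  \<open>k k\<^sup>* \<in> p L p\<close>.
\<close>

lemma in_LM_by_corner:
  assumes "R \<odot> p = R" and "\<And>l. l \<in> corner p p \<Longrightarrow> R \<odot> to_bidual l \<in> range to_bidual"
  shows "R \<in> LM"
proof -
  have "R \<odot> to_bidual l \<in> range to_bidual" for l
  proof -
    obtain k where k: "p \<odot> to_bidual l = to_bidual k"
      using p_q_LM_RM by (auto simp: LM_def)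
    have "to_bidual (star k) = bidual_star (p \<odot> to_bidual l)"
      by (simp add: to_bidual_star k)
    then have star_k: "to_bidual (star k) = to_bidual (star l) \<odot> p"
      by (simp add: bidual_star_arens_to_bidual projections_simps)
    have "R \<odot> to_bidual k \<in> range to_bidual"
    proof (rule arens_in_range_by_factorization)
      fix z
      have "k * star k \<in> corner p p"
        unfolding corner_def
        by (auto intro!: exI[of _ "l * star l"] simp: to_bidual_mult star_k arens_assoc simp flip: k)
      then show "R \<odot> to_bidual (k * star k * z) \<in> range to_bidual"
        using range_to_bidual_arens[OF assms(2) rangeI, of "k * star k" z]
        by (simp add: to_bidual_mult[of _ z] arens_assoc)
    qed
    then show ?thesis
      unfolding k[symmetric] arens_assoc[symmetric] assms(1) .
  qed
  then show ?thesis
    by (simp add: LM_def)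
qed

lemma in_QM_by_corner:
  assumes R: "p \<odot> R = R" "R \<odot> p = R"
    and corner: "\<And>l m. l \<in> corner p p \<Longrightarrow> m \<in> corner p p \<Longrightarrow> to_bidual l \<odot> R \<odot> to_bidual m \<in> range to_bidual"
  shows "R \<in> QM"
proof -
  have LM: "to_bidual l \<odot> R \<in> LM" if "l \<in> corner p p" for l
    using that by (intro in_LM_by_corner corner) (simp_all add: arens_assoc R)
  have "to_bidual a \<odot> (R \<odot> to_bidual b) \<in> range to_bidual" for a b
  proof -
    obtain k where k: "to_bidual a \<odot> p = to_bidual k"
      using p_q_LM_RM by (auto simp: RM_def)
    have "to_bidual (star k) = bidual_star (to_bidual a \<odot> p)"
      by (simp add: to_bidual_star k)
    then have star_k: "to_bidual (star k) = p \<odot> to_bidual (star a)"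
      by (simp add: bidual_star_to_bidual_arens projections_simps)
    have "to_bidual k \<odot> (R \<odot> to_bidual b) \<in> range to_bidual"
    proof (rule arens_in_range_by_factorization_left)
      fix z
      have "star k * k \<in> corner p p"
        unfolding corner_def
        by (auto intro!: exI[of _ "star a * a"] simp: to_bidual_mult star_k arens_assoc simp flip: k)
      then have "to_bidual (star k * k) \<odot> R \<odot> to_bidual b \<in> range to_bidual"
        using LM by (simp add: LM_def)
      then have "to_bidual z \<odot> (to_bidual (star k * k) \<odot> R \<odot> to_bidual b) \<in> range to_bidual"
        by (rule range_to_bidual_arens[OF rangeI])
      then show "to_bidual (z * star k * k) \<odot> (R \<odot> to_bidual b) \<in> range to_bidual"
        by (simp add: to_bidual_mult arens_assoc)
    qed
    moreover have "to_bidual k \<odot> (R \<odot> to_bidual b) = to_bidual a \<odot> ((p \<odot> R) \<odot> to_bidual b)"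
      by (simp only: k[symmetric] arens_assoc)
    ultimately show ?thesis
      by (simp only: R)
  qed
  then show ?thesis
    by (simp add: QM_def arens_assoc)
qed

text \<open>
  Let \<open>\<pi>\<close> be the compression \<open>l \<mapsto> p l p\<close> followed by the inverse of \<open>\<iota>\<close>. The bitransposes satisfy
  \<open>\<pi>\<^sup>*\<^sup>* \<iota>\<^sup>*\<^sup>* = id\<close> and \<open>\<iota>\<^sup>*\<^sup>* \<pi>\<^sup>*\<^sup>* T = p T p\<close>. Hence, \<open>\<iota>\<^sup>*\<^sup>*\<close> identifies \<open>A\<^sup>*\<^sup>*\<close> with
  \<open>p L\<^sup>*\<^sup>* p\<close>, and under this identification (quasi-)multipliers of \<open>A\<close> are those of \<open>L\<close> in the corner.
\<close>

proposition QM_eq_M_iff_corner: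
  fixes \<iota> :: "'a :: cstar_algebra \<Rightarrow> 'l"
  assumes \<iota>: "is_cstar_embedding \<iota>" and range: "range \<iota> = corner p p"
  shows "(QM :: 'a bidual set) = M \<longleftrightarrow> (\<forall>T\<in>QM. p \<odot> T \<odot> p \<in> LM)"
proof -
  have add: "\<iota> (x + y) = \<iota> x + \<iota> y" and scale: "\<iota> (c *\<^sub>C x) = c *\<^sub>C \<iota> x" and norm: "norm (\<iota> x) = norm x"
    and mult: "\<iota> (x * y) = \<iota> x * \<iota> y" for x y c
    using \<iota> by (auto simp: is_cstar_embedding_def is_linear_isometry_def)
  have \<iota>_lin: "bounded_clinear \<iota>"
    by (rule bounded_clinearI[of _ 1]) (simp_all add: add scale norm)
  have inj: "x = y" if "\<iota> x = \<iota> y" for x y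
  proof -
    have "\<iota> (x - y) + \<iota> y = \<iota> x"
      by (simp flip: add)
    then have "norm (x - y) = 0"
      using that norm[of "x - y"] by simp
    then show ?thesis
      by simp
  qed
  have "\<exists>a. to_bidual (\<iota> a) = p \<odot> to_bidual l \<odot> p" for l
  proof -
    obtain x where x: "to_bidual x = p \<odot> to_bidual l \<odot> p"
      using ex_compression by blast
    then have "x \<in> range \<iota>"
      unfolding range corner_def by blast
    with x show ?thesis
      by auto
  qed
  then obtain \<pi> where \<pi>: "\<And>l. to_bidual (\<iota> (\<pi> l)) = p \<odot> to_bidual l \<odot> p"
    by metis
  have \<pi>_eqI: "\<pi> l = a" if "p \<odot> to_bidual l \<odot> p = to_bidual (\<iota> a)" for l a
  proof -
    have "to_bidual (\<iota> (\<pi> l)) = to_bidual (\<iota> a)"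
      by (simp only: \<pi> that)
    then show ?thesis
      by (rule inj[OF injD[OF inj_to_bidual]])
  qed
  have \<pi>_lin: "bounded_clinear \<pi>"
  proof (rule bounded_clinearI)
    show "\<pi> (x + y) = \<pi> x + \<pi> y" for x y
      by (rule \<pi>_eqI) (simp add: add to_bidual_add \<pi> arens_add_left arens_add_right)
    show "\<pi> (c *\<^sub>C x) = c *\<^sub>C \<pi> x" for c x
      by (rule \<pi>_eqI) (simp add: scale to_bidual_scaleC \<pi> arens_scaleC_left arens_scaleC_right)
    show "norm (\<pi> x) \<le> norm x * (norm p * norm p)" for x
    proof -
      have "norm (\<pi> x) = norm (p \<odot> to_bidual x \<odot> p)"
        by (simp add: norm norm_to_bidual flip: \<pi>)
      also have "\<dots> \<le> norm (p \<odot> to_bidual x) * norm p"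
        by (rule norm_arens)
      also have "\<dots> \<le> norm p * norm (to_bidual x) * norm p"
        by (intro mult_right_mono norm_arens) simp
      finally show ?thesis
        by (simp add: norm_to_bidual mult_ac)
    qed
  qed
  have corner_simps: "p \<odot> to_bidual (\<iota> a) = to_bidual (\<iota> a)" "to_bidual (\<iota> a) \<odot> p = to_bidual (\<iota> a)" for a
  proof -
    have "\<iota> a \<in> corner p p"
      by (simp flip: range)
    then obtain l where "to_bidual (\<iota> a) = p \<odot> to_bidual l \<odot> p"
      by (auto simp: corner_def)
    then show "p \<odot> to_bidual (\<iota> a) = to_bidual (\<iota> a)" "to_bidual (\<iota> a) \<odot> p = to_bidual (\<iota> a)"
      by (simp_all add: arens_assoc projections_simps)
  qed
  have \<pi>_\<iota>: "\<pi> (\<iota> a) = a" for a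
    by (rule \<pi>_eqI) (simp add: corner_simps)
  have comp_lin: "bounded_clinear (\<lambda>l. \<iota> (\<pi> l))"
    using \<iota>_lin \<pi>_lin bounded_linear_compose[of \<iota> \<pi>] by (simp add: bounded_clinear_def)
  let ?\<iota> = "bitranspose \<iota>" and ?\<pi> = "bitranspose \<pi>"
  have \<pi>\<iota>: "?\<pi> (?\<iota> T) = T" for T
  proof -
    have id: "bounded_clinear (\<lambda>x :: 'a. x)"
      by (simp add: bounded_clinear_def bounded_linear_ident)
    have "?\<pi> (?\<iota> T) = bitranspose (\<lambda>x. x) T"
      by (rule bitranspose_bitranspose[OF \<pi>_lin \<iota>_lin id \<pi>_\<iota>])
    then show ?thesis
      by (simp add: bitranspose_id[OF id])
  qed
  have \<iota>\<pi>: "?\<iota> (?\<pi> T) = p \<odot> T \<odot> p" for T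
    using bitranspose_bitranspose[OF \<iota>_lin \<pi>_lin comp_lin refl, of T] bitranspose_compression[OF comp_lin \<pi>, of T]
    by simp
  have in_range: "T \<in> range to_bidual \<longleftrightarrow> ?\<iota> T \<in> range to_bidual" for T
  proof
    assume "?\<iota> T \<in> range to_bidual"
    then obtain l where "?\<iota> T = to_bidual l"
      by blast
    then have "T = to_bidual (\<pi> l)"
      using \<pi>\<iota>[of T] bitranspose_to_bidual[OF \<pi>_lin, of l] by simp
    then show "T \<in> range to_bidual"
      by (rule range_eqI)
  qed (auto simp: bitranspose_to_bidual[OF \<iota>_lin])
  have fixed: "p \<odot> ?\<iota> T = ?\<iota> T" "?\<iota> T \<odot> p = ?\<iota> T" for T
  proof -
    have "?\<iota> T = p \<odot> ?\<iota> T \<odot> p"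
      using \<iota>\<pi>[of "?\<iota> T"] by (simp only: \<pi>\<iota>)
    then show "p \<odot> ?\<iota> T = ?\<iota> T" "?\<iota> T \<odot> p = ?\<iota> T"
      using projections_simps by (metis arens_assoc)+
  qed
  note \<iota>_arens = bitranspose_to_bidual_arens[OF \<iota>_lin mult] bitranspose_arens_to_bidual[OF \<iota>_lin mult]
  have QM: "T \<in> QM \<longleftrightarrow> ?\<iota> T \<in> QM" for T
  proof
    assume "T \<in> QM"
    then have *: "to_bidual (\<iota> a) \<odot> ?\<iota> T \<odot> to_bidual (\<iota> b) \<in> range to_bidual" for a b
      using in_range[of "to_bidual a \<odot> T \<odot> to_bidual b"] by (simp add: QM_def \<iota>_arens)
    show "?\<iota> T \<in> QM"
      using * by (intro in_QM_by_corner fixed) (auto simp flip: range)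
  next
    assume "?\<iota> T \<in> QM"
    then show "T \<in> QM"
      by (simp add: QM_def in_range[of "_ \<odot> _"] \<iota>_arens)
  qed
  have LM: "T \<in> LM \<longleftrightarrow> ?\<iota> T \<in> LM" for T
  proof
    assume "T \<in> LM"
    then have *: "?\<iota> T \<odot> to_bidual (\<iota> b) \<in> range to_bidual" for b
      using in_range[of "T \<odot> to_bidual b"] by (simp add: LM_def \<iota>_arens)
    show "?\<iota> T \<in> LM"
      using * by (intro in_LM_by_corner fixed) (auto simp flip: range)
  next
    assume "?\<iota> T \<in> LM"
    then show "T \<in> LM"
      by (simp add: LM_def in_range[of "_ \<odot> _"] \<iota>_arens)
  qed
  have "(QM :: 'a bidual set) \<subseteq> LM \<longleftrightarrow> (\<forall>T\<in>QM. p \<odot> T \<odot> p \<in> LM)"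
  proof
    assume sub: "(QM :: 'a bidual set) \<subseteq> LM"
    show "\<forall>T\<in>QM. p \<odot> T \<odot> p \<in> LM"
    proof
      fix T :: "'l bidual" assume "T \<in> QM"
      then have "?\<iota> (?\<pi> T) \<in> QM"
        unfolding \<iota>\<pi> using p_q_LM_RM by (intro QM_arens_right QM_arens_left)
      then show "p \<odot> T \<odot> p \<in> LM"
        using sub QM LM by (auto simp flip: \<iota>\<pi>)
    qed
  next
    assume *: "\<forall>T\<in>QM. p \<odot> T \<odot> p \<in> LM"
    show "(QM :: 'a bidual set) \<subseteq> LM"
    proof
      fix T :: "'a bidual" assume "T \<in> QM"
      then have "p \<odot> ?\<iota> T \<odot> p \<in> LM"
        using * QM by blast
      then show "T \<in> LM"
        by (simp add: LM fixed)
    qed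
  qed
  then show ?thesis
    by (simp only: QM_eq_M_iff)
qed

end


section \<open>Multipliers of imprimitivity bimodules\<close>

context complementary_projections
begin

text \<open>
  Both sides are equivalent to \<open>p QM(L) \<subseteq> LM(L)\<close>, one because \<open>q L q\<close> is full and the other
  because \<open>p L p\<close> is full.
\<close>

theorem QMX_eq_LMX_iff_corner_QM_eq_M:
  fixes \<iota> :: "'a :: cstar_algebra \<Rightarrow> 'l"
  assumes \<iota>: "is_cstar_embedding \<iota>" "range \<iota> = corner p p"
    and full: "closed_ideal_generated (corner p p) = UNIV" "closed_ideal_generated (corner q q) = UNIV"
  shows "QMX p q = LMX p q \<longleftrightarrow> (QM :: 'a bidual set) = M"
  unfolding QMX_eq_LMX_iff QM_eq_M_iff_corner[OF \<iota>]
    full_corner_LM_iff[OF q_mult full(2)] full_corner_LM_iff[OF p_mult full(1)] ..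

text \<open>
  If \<open>p QM(L) q \<subseteq> M(L)\<close>, then fullness of \<open>q L q\<close> gives \<open>p QM(L) \<subseteq> LM(L)\<close>. Adjoints turn the inclusion
  into \<open>q QM(L) p \<subseteq> M(L)\<close>, and fullness of \<open>p L p\<close> gives \<open>q QM(L) \<subseteq> LM(L)\<close>. Adding the two shows
  \<open>QM(L) \<subseteq> LM(L)\<close>.
\<close>

theorem QMX_eq_MX_iff_QM_eq_M:
  assumes full: "closed_ideal_generated (corner p p) = UNIV" "closed_ideal_generated (corner q q) = UNIV"
  shows "QMX p q = MX p q \<longleftrightarrow> (QM :: 'l bidual set) = M"
proof
  assume "(QM :: 'l bidual set) = M"
  then show "QMX p q = MX p q"
    by (simp add: QMX_def MX_def)
next
  assume eq: "QMX p q = MX p q"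
  have M: "p \<odot> T \<odot> q \<in> LM" "p \<odot> T \<odot> q \<in> RM" if "T \<in> QM" for T
  proof -
    have "p \<odot> T \<odot> q \<in> MX p q"
      unfolding eq[symmetric] QMX_def using that by (rule imageI)
    then obtain S where S: "S \<in> M" "p \<odot> T \<odot> q = p \<odot> S \<odot> q"
      unfolding MX_def by blast
    then show "p \<odot> T \<odot> q \<in> LM" "p \<odot> T \<odot> q \<in> RM"
      using compression_LM[of S] compression_RM[of S] by (simp_all add: M_def)
  qed
  have p: "p \<odot> T \<in> LM" if "T \<in> QM" for T
    using that full_corner_LM_iff[OF q_mult full(2), of p] M(1) by blast
  have "q \<odot> T \<odot> p \<in> LM" if "T \<in> QM" for T
  proof -
    have "bidual_star (p \<odot> bidual_star T \<odot> q) \<in> LM"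
      using M(2)[OF bidual_star_QM[OF that]] by (simp only: bidual_star_LM_iff)
    then show ?thesis
      by (simp add: bidual_star_corner bidual_star_star)
  qed
  then have q: "q \<odot> T \<in> LM" if "T \<in> QM" for T
    using that full_corner_LM_iff[OF p_mult full(1), of q] by blast
  have "QM \<subseteq> (LM :: 'l bidual set)"
  proof
    fix T :: "'l bidual" assume "T \<in> QM"
    then have "p \<odot> T + q \<odot> T \<in> LM"
      using p[of T] q[of T] by (simp add: LM_def arens_add_left range_to_bidual_add)
    then show "T \<in> LM"
      by (simp only: decompose)
  qed
  then show "(QM :: 'l bidual set) = M"
    by (simp only: QM_eq_M_iff)
qed

end

lemma (in hilbert_cstar_bimodule) complementary_projections: "complementary_projections p q"
  using p_mult p_proj q_mult q_proj p_plus_q by (rule complementary_projections.intro)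

theorem proposition2p7:
  fixes lact :: "'a :: cstar_algebra \<Rightarrow> 'x :: complex_normed_vector \<Rightarrow> 'x"
    and ract :: "'x \<Rightarrow> 'b :: cstar_algebra \<Rightarrow> 'x"
    and lip :: "'x \<Rightarrow> 'x \<Rightarrow> 'a"
    and rip :: "'x \<Rightarrow> 'x \<Rightarrow> 'b"
    and p q :: "'l :: cstar_algebra bidual"
    and iA :: "'a \<Rightarrow> 'l" and iB :: "'b \<Rightarrow> 'l" and iX :: "'x \<Rightarrow> 'l"
  shows
    "((LM :: 'c :: cstar_algebra bidual set) = M \<longleftrightarrow> (QM :: 'c bidual set) = M) \<and>
     (hilbert_cstar_bimodule lact ract lip rip p q iA iB iX \<longrightarrow>
        (QMX p q = LMX p q \<longleftrightarrow> RMX p q \<subseteq> LMX p q) \<and>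
        (QMX p q = RMX p q \<longleftrightarrow> LMX p q \<subseteq> RMX p q)) \<and>
     (imprimitivity_bimodule lact ract lip rip p q iA iB iX \<longrightarrow>
        (QMX p q = LMX p q \<longleftrightarrow> (QM :: 'a bidual set) = M) \<and>
        (QMX p q = RMX p q \<longleftrightarrow> (QM :: 'b bidual set) = M) \<and>
        (QMX p q = MX p q \<longleftrightarrow> (QM :: 'l bidual set) = M))"
proof (intro conjI[OF LM_eq_M_iff_QM_eq_M] conjI impI)
  assume "hilbert_cstar_bimodule lact ract lip rip p q iA iB iX"
  then interpret complementary_projections p q
    by (rule hilbert_cstar_bimodule.complementary_projections)
  show "QMX p q = LMX p q \<longleftrightarrow> RMX p q \<subseteq> LMX p q" "QMX p q = RMX p q \<longleftrightarrow> LMX p q \<subseteq> RMX p q"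
    by (rule QMX_eq_LMX_iff_RMX_subset_LMX QMX_eq_RMX_iff_LMX_subset_RMX)+
next
  assume "imprimitivity_bimodule lact ract lip rip p q iA iB iX"
  then interpret imprimitivity_bimodule lact ract lip rip p q iA iB iX .
  interpret complementary_projections p q
    by (rule complementary_projections)
  interpret swapped: complementary_projections q p
    by (rule swap)
  note full = A_full[unfolded range_iA] B_full[unfolded range_iB]
  show "QMX p q = LMX p q \<longleftrightarrow> (QM :: 'a bidual set) = M"
    by (rule QMX_eq_LMX_iff_corner_QM_eq_M[OF iA range_iA full])
  show "QMX p q = RMX p q \<longleftrightarrow> (QM :: 'b bidual set) = M"
    unfolding QMX_eq_RMX_iff_swap
    by (rule swapped.QMX_eq_LMX_iff_corner_QM_eq_M[OF iB range_iB full(2,1)])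
  show "QMX p q = MX p q \<longleftrightarrow> (QM :: 'l bidual set) = M"
    by (rule QMX_eq_MX_iff_QM_eq_M[OF full])
qed

end
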